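(* Let $G$ be a locally compact (Hausdorff) abelian group which is countable at infinity, let $D$ be a compact subset of the dual group $\hat G$, and let $\mathcal{H}_D$ be the reproducing kernel Hilbert space of functions in $L^2(G)$ whose Fourier transform is supported on $D$, with coherent states $\phi_x$, $x\in G$. Let $y_1,y_2,\dots$ be a sequence in $G$, put $\phi_j=\phi_{y_j}$, and assume that the $\phi_j$ form a frame in $\mathcal{H}_D$: there are constants $0<A\le B<\infty$ such that $$A\|f\|^2\le\sum_j\bigl|\langle f\mid\phi_j\rangle\bigr|^2\le B\|f\|^2\qquad\text{for all }f\in\mathcal{H}_D.$$ Then $$S(f)=\sum_j f(y_j)\,\phi_j$$ defines an invertible bounded positive operator on $\mathcal{H}_D$, and for all $f\in\mathcal{H}_D$ and $x\in G$ we have $$f(x)=\sum_j f(y_j)\,\bigl(S^{-1}\phi_j\bigr)(x).$$ The first series (defining $S(f)$) converges in norm, and the second series converges absolutely and uniformly on compact subsets of $G$.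
   Context: "Countable at infinity" means $\sigma$-compact. $\hat G$ is the group of continuous unitary characters of $G$ with the topology of uniform convergence on compact sets. Haar measures $\mu$ on $G$ and $\nu$ on $\hat G$ are normalized so that the Fourier transform $\hat f(\chi)=\int_G f(x)\overline{\chi(x)}\,d\mu(x)$ extends to an isometry $L^2(G)\to L^2(\hat G)$, with inverse $F\mapsto\bigl(x\mapsto\int_{\hat G}\chi(x)F(\chi)\,d\nu(\chi)\bigr)$. $\langle f\mid g\rangle=\int_G f\,\overline{g}\,d\mu$. $\mathcal{H}_D$ is the space of $f\in L^2(G)$ with $\hat f=0$ almost everywhere outside $D$; each such $f$ is identified with its continuous representative $x\mapsto\int_D\hat f(\chi)\chi(x)\,d\nu(\chi)$. With $g_D(x)=\int_D\chi(x)\,d\nu(\chi)$, the reproducing kernel is $K(x,y)=g_D(x-y)$ (group law written additively) and the coherent state at $x$ is $\phi_x\in\mathcal{H}_D$, $\phi_x(y)=g_D(y-x)$, so that $f(x)=\langle f\mid\phi_x\rangle$ for all $f\in\mathcal{H}_D$. *)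

theory Defs
  imports "HOL-Analysis.Analysis"
begin

section \<open>Sigma-compactness and Haar measures\<close>

definition sigma_compact :: "'a::topological_space set \<Rightarrow> bool" where
  "sigma_compact S \<longleftrightarrow> (\<exists>K :: nat \<Rightarrow> 'a set. (\<forall>n. compact (K n)) \<and> S = (\<Union>n. K n))"

text \<open>
  A Haar measure is a nonzero translation-invariant Radon measure. The dual of a
  sigma-compact group need not be sigma-compact, so the convention for Radon measures
  matters: outer regular on Borel sets, inner regular on open sets.
\<close>

definition haar_measure :: "'a::{topological_ab_group_add, t2_space} measure \<Rightarrow> bool" where
  "haar_measure M \<longleftrightarrow>
     sets M = sets borel \<and>
     emeasure M UNIV \<noteq> 0 \<and>
     (\<forall>K. compact K \<longrightarrow> emeasure M K < \<infinity>) \<and>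
     (\<forall>A\<in>sets borel. emeasure M A = (INF U\<in>{U. open U \<and> A \<subseteq> U}. emeasure M U)) \<and>
     (\<forall>U. open U \<longrightarrow> emeasure M U = (SUP K\<in>{K. compact K \<and> K \<subseteq> U}. emeasure M K)) \<and>
     (\<forall>a. \<forall>A\<in>sets borel. emeasure M ((+) a ` A) = emeasure M A)"


section \<open>The dual group\<close>

typedef (overloaded) 'a character =
  "{\<xi> :: ('a::topological_ab_group_add) \<Rightarrow> complex.
      continuous_on UNIV \<xi> \<and> (\<forall>x. norm (\<xi> x) = 1) \<and> (\<forall>x y. \<xi> (x + y) = \<xi> x * \<xi> y)}"
  morphisms chr Character
  by (intro exI[of _ "\<lambda>_. 1"]) auto

lemma continuous_on_chr: "continuous_on UNIV (chr \<xi>)"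
  and norm_chr [simp]: "norm (chr \<xi> x) = 1"
  and chr_add: "chr \<xi> (x + y) = chr \<xi> x * chr \<xi> y"
  using chr[of \<xi>] by auto

lemma chr_nonzero [simp]: "chr \<xi> x \<noteq> 0"
  using norm_chr[of \<xi> x] by (metis norm_zero zero_neq_one)

lemma character_eqI: "(\<And>x. chr \<xi> x = chr \<psi> x) \<Longrightarrow> \<xi> = \<psi>"
  by (metis chr_inject ext)

text \<open>
  The pointwise product of characters is written additively, so that the dual group is again
  an instance of \<^class>\<open>topological_ab_group_add\<close>.
\<close>

instantiation character :: (topological_ab_group_add) ab_group_add
begin

definition "0 = Character (\<lambda>_. 1)"
definition "\<xi> + \<psi> = Character (\<lambda>x. chr \<xi> x * chr \<psi> x)"
definition "- \<xi> = Character (\<lambda>x. cnj (chr \<xi> x))"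
definition "\<xi> - \<psi> = \<xi> + (- \<psi> :: 'a character)"

lemma chr_zero [simp]: "chr 0 x = 1"
  unfolding zero_character_def by (subst Character_inverse) auto

lemma chr_plus [simp]: "chr (\<xi> + \<psi>) x = chr \<xi> x * chr \<psi> x"
  unfolding plus_character_def
  by (subst Character_inverse) (auto simp: norm_mult chr_add intro!: continuous_intros continuous_on_chr)

lemma chr_uminus [simp]: "chr (- \<xi>) x = cnj (chr \<xi> x)"
  unfolding uminus_character_def
  by (subst Character_inverse) (auto simp: chr_add intro!: continuous_intros continuous_on_chr)

instance
proof
  fix a b c :: "'a character"
  show "- a + a = 0"
    by (rule character_eqI)
       (metis chr_plus chr_uminus chr_zero complex_norm_square mult.commute norm_chr of_real_1 power_one)
qed (auto intro!: character_eqI simp: minus_character_def)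

end

text \<open>The topology of uniform convergence on compact sets.\<close>

instantiation character :: (topological_ab_group_add) topological_space
begin

definition open_character :: "'a character set \<Rightarrow> bool" where
  "open_character U \<longleftrightarrow>
     (\<forall>\<xi>\<in>U. \<exists>K e. compact K \<and> e > 0 \<and>
        (\<forall>\<psi>. (\<forall>x\<in>K. dist (chr \<psi> x) (chr \<xi> x) < e) \<longrightarrow> \<psi> \<in> U))"

instance
proof
  show "open (UNIV :: 'a character set)"
    unfolding open_character_def by (auto intro: exI[of _ "{}"] exI[of _ 1])
next
  fix S T :: "'a character set"
  assume *: "open S" "open T"
  show "open (S \<inter> T)"
    unfolding open_character_def
  proof
    fix \<xi> assume "\<xi> \<in> S \<inter> T"
    with * obtain K e L d where
      "compact K" "e > 0" "\<And>\<psi>. (\<forall>x\<in>K. dist (chr \<psi> x) (chr \<xi> x) < e) \<Longrightarrow> \<psi> \<in> S"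
      "compact L" "d > 0" "\<And>\<psi>. (\<forall>x\<in>L. dist (chr \<psi> x) (chr \<xi> x) < d) \<Longrightarrow> \<psi> \<in> T"
      unfolding open_character_def by (metis IntE)
    then show "\<exists>K e. compact K \<and> e > 0 \<and>
        (\<forall>\<psi>. (\<forall>x\<in>K. dist (chr \<psi> x) (chr \<xi> x) < e) \<longrightarrow> \<psi> \<in> S \<inter> T)"
      by (intro exI[of _ "K \<union> L"] exI[of _ "min e d"]) auto
  qed
next
  fix \<S> :: "'a character set set"
  assume "\<forall>S\<in>\<S>. open S"
  then show "open (\<Union>\<S>)"
    unfolding open_character_def by (meson Union_iff)
qed

end

lemma open_character_ball:
  assumes "compact K" "e > 0"
  shows "open {\<psi>. \<forall>x\<in>K. dist (chr \<psi> x) (chr \<xi> x) < e}"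
  unfolding open_character_def
proof
  fix \<psi> assume \<psi>: "\<psi> \<in> {\<psi>. \<forall>x\<in>K. dist (chr \<psi> x) (chr \<xi> x) < e}"
  obtain m where m: "m < e" "\<And>x. x \<in> K \<Longrightarrow> dist (chr \<psi> x) (chr \<xi> x) \<le> m"
  proof (cases "K = {}")
    case True
    then show ?thesis using that[of 0] assms by auto
  next
    case False
    have "continuous_on K (\<lambda>x. dist (chr \<psi> x) (chr \<xi> x))"
      by (intro continuous_intros continuous_on_subset[OF continuous_on_chr]) auto
    from continuous_attains_sup[OF assms(1) False this] \<psi> that show ?thesis by blast
  qed
  show "\<exists>L d. compact L \<and> d > 0 \<and> (\<forall>\<theta>. (\<forall>x\<in>L. dist (chr \<theta> x) (chr \<psi> x) < d) \<longrightarrow>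
      \<theta> \<in> {\<psi>. \<forall>x\<in>K. dist (chr \<psi> x) (chr \<xi> x) < e})"
  proof (intro exI[of _ K] exI[of _ "e - m"] conjI allI impI)
    fix \<theta> assume \<theta>: "\<forall>x\<in>K. dist (chr \<theta> x) (chr \<psi> x) < e - m"
    have "dist (chr \<theta> x) (chr \<xi> x) < e" if "x \<in> K" for x
      using \<theta> m(2)[OF that] that dist_triangle[of "chr \<theta> x" "chr \<xi> x" "chr \<psi> x"] by fastforce
    then show "\<theta> \<in> {\<psi>. \<forall>x\<in>K. dist (chr \<psi> x) (chr \<xi> x) < e}" by auto
  qed (use assms m in auto)
qed

lemma eventually_nhds_character:
  "eventually P (nhds \<xi>) \<longleftrightarrow>
     (\<exists>K e. compact K \<and> e > 0 \<and> (\<forall>\<psi>. (\<forall>x\<in>K. dist (chr \<psi> x) (chr \<xi> x) < e) \<longrightarrow> P \<psi>))"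
proof
  assume "eventually P (nhds \<xi>)"
  then obtain S where S: "open S" "\<xi> \<in> S" "\<And>x. x \<in> S \<Longrightarrow> P x"
    unfolding eventually_nhds by blast
  obtain K e where "compact K" "e > 0" "\<And>\<psi>. (\<forall>x\<in>K. dist (chr \<psi> x) (chr \<xi> x) < e) \<Longrightarrow> \<psi> \<in> S"
    using S(1,2) unfolding open_character_def by meson
  then show "\<exists>K e. compact K \<and> e > 0 \<and> (\<forall>\<psi>. (\<forall>x\<in>K. dist (chr \<psi> x) (chr \<xi> x) < e) \<longrightarrow> P \<psi>)"
    using S(3) by meson
next
  assume "\<exists>K e. compact K \<and> e > 0 \<and> (\<forall>\<psi>. (\<forall>x\<in>K. dist (chr \<psi> x) (chr \<xi> x) < e) \<longrightarrow> P \<psi>)"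
  then obtain K e where *: "compact K" "e > 0" "\<And>\<psi>. (\<forall>x\<in>K. dist (chr \<psi> x) (chr \<xi> x) < e) \<Longrightarrow> P \<psi>"
    by blast
  show "eventually P (nhds \<xi>)"
    unfolding eventually_nhds
    by (rule exI[of _ "{\<psi>. \<forall>x\<in>K. dist (chr \<psi> x) (chr \<xi> x) < e}"])
       (use * open_character_ball[OF *(1,2)] in auto)
qed

lemma dist_mult_le:
  fixes a b c d :: complex
  assumes "norm a = 1" "norm d = 1"
  shows "dist (a * b) (c * d) \<le> dist a c + dist b d"
proof -
  have "a * b - c * d = a * (b - d) + (a - c) * d"
    by (simp add: algebra_simps)
  then show ?thesis
    using norm_triangle_ineq[of "a * (b - d)" "(a - c) * d"] assms
    by (simp add: dist_norm norm_mult)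
qed

instance character :: (topological_ab_group_add) topological_ab_group_add
proof
  fix a b :: "'a character"
  show "LIM x (nhds a \<times>\<^sub>F nhds b). fst x + snd x :> nhds (a + b)"
    unfolding filterlim_iff
  proof (intro allI impI)
    fix P assume "eventually P (nhds (a + b))"
    then obtain K e where K: "compact K" "e > 0"
      "\<And>\<psi>. (\<forall>x\<in>K. dist (chr \<psi> x) (chr (a + b) x) < e) \<Longrightarrow> P \<psi>"
      unfolding eventually_nhds_character by blast
    have ev: "eventually (\<lambda>\<psi>. \<forall>x\<in>K. dist (chr \<psi> x) (chr c x) < e / 2) (nhds c)" for c
      unfolding eventually_nhds_character using K by (intro exI[of _ K] exI[of _ "e / 2"]) auto
    have "P (\<psi> + \<theta>)"
      if "\<forall>x\<in>K. dist (chr \<psi> x) (chr a x) < e / 2" "\<forall>x\<in>K. dist (chr \<theta> x) (chr b x) < e / 2" for \<psi> \<theta>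
    proof (rule K(3), rule ballI)
      fix x assume "x \<in> K"
      with that have "dist (chr \<psi> x) (chr a x) < e / 2" "dist (chr \<theta> x) (chr b x) < e / 2" by auto
      then show "dist (chr (\<psi> + \<theta>) x) (chr (a + b) x) < e"
        using dist_mult_le[of "chr \<psi> x" "chr b x" "chr \<theta> x" "chr a x"] by simp
    qed
    then show "eventually (\<lambda>x. P (fst x + snd x)) (nhds a \<times>\<^sub>F nhds b)"
      unfolding eventually_prod_filter using ev[of a] ev[of b]
      by (intro exI[of _ "\<lambda>\<psi>. \<forall>x\<in>K. dist (chr \<psi> x) (chr a x) < e / 2"]
                exI[of _ "\<lambda>\<psi>. \<forall>x\<in>K. dist (chr \<psi> x) (chr b x) < e / 2"]) simp
  qed
  show "(uminus \<longlongrightarrow> - a) (nhds a)"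
    unfolding filterlim_iff
  proof (intro allI impI)
    fix P assume "eventually P (nhds (- a))"
    then obtain K e where K: "compact K" "e > 0"
      "\<And>\<psi>. (\<forall>x\<in>K. dist (chr \<psi> x) (chr (- a) x) < e) \<Longrightarrow> P \<psi>"
      unfolding eventually_nhds_character by blast
    have "dist (cnj u) (cnj v) = dist u v" for u v
      by (metis complex_cnj_diff complex_mod_cnj dist_norm)
    with K show "eventually (\<lambda>x. P (- x)) (nhds a)"
      unfolding eventually_nhds_character by (intro exI[of _ K] exI[of _ e]) auto
  qed
qed

instance character :: (topological_ab_group_add) t2_space
proof
  fix \<xi> \<psi> :: "'a character"
  assume "\<xi> \<noteq> \<psi>"
  then obtain x where x: "chr \<xi> x \<noteq> chr \<psi> x"
    using character_eqI by blast
  define e where "e = dist (chr \<xi> x) (chr \<psi> x) / 2"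
  have e: "e > 0" using x by (simp add: e_def)
  let ?B = "\<lambda>c. {\<theta>. \<forall>y\<in>{x}. dist (chr \<theta> y) (chr c y) < e}"
  have "?B \<xi> \<inter> ?B \<psi> = {}"
  proof -
    have False if "dist z (chr \<xi> x) < e" "dist z (chr \<psi> x) < e" for z
      using that dist_triangle2[of "chr \<xi> x" "chr \<psi> x" z] by (simp add: e_def dist_commute)
    then show ?thesis by auto
  qed
  moreover have "open (?B \<xi>)" "open (?B \<psi>)"
    by (intro open_character_ball e; simp)+
  ultimately show "\<exists>U V. open U \<and> open V \<and> \<xi> \<in> U \<and> \<psi> \<in> V \<and> U \<inter> V = {}"
    using e by (intro exI[of _ "?B \<xi>"] exI[of _ "?B \<psi>"]) auto
qed


section \<open>Square-integrable functions and the Fourier transform\<close>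

definition L1 :: "'a measure \<Rightarrow> ('a \<Rightarrow> complex) set" where
  "L1 M = {f. integrable M f}"

definition L2 :: "'a measure \<Rightarrow> ('a \<Rightarrow> complex) set" where
  "L2 M = {f \<in> borel_measurable M. integrable M (\<lambda>x. (norm (f x))\<^sup>2)}"

definition L2_norm :: "'a measure \<Rightarrow> ('a \<Rightarrow> complex) \<Rightarrow> real" where
  "L2_norm M f = sqrt (LINT x|M. (norm (f x))\<^sup>2)"

definition L2_inner :: "'a measure \<Rightarrow> ('a \<Rightarrow> complex) \<Rightarrow> ('a \<Rightarrow> complex) \<Rightarrow> complex" where
  "L2_inner M f g = (LINT x|M. f x * cnj (g x))"

definition L2_lim :: "'a measure \<Rightarrow> (nat \<Rightarrow> 'a \<Rightarrow> complex) \<Rightarrow> ('a \<Rightarrow> complex) \<Rightarrow> bool" where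
  "L2_lim M g f \<longleftrightarrow> (\<forall>n. (\<lambda>x. g n x - f x) \<in> L2 M) \<and>
     (\<lambda>n. L2_norm M (\<lambda>x. g n x - f x)) \<longlonglongrightarrow> 0"

definition fourier :: "'a::topological_ab_group_add measure \<Rightarrow> ('a \<Rightarrow> complex) \<Rightarrow> 'a character \<Rightarrow> complex" where
  "fourier \<mu> f \<xi> = (LINT x|\<mu>. f x * cnj (chr \<xi> x))"

definition inverse_fourier ::
    "'a::topological_ab_group_add character measure \<Rightarrow> ('a character \<Rightarrow> complex) \<Rightarrow> 'a \<Rightarrow> complex" where
  "inverse_fourier \<nu> F x = (LINT \<xi>|\<nu>. chr \<xi> x * F \<xi>)"

text \<open>
  \<open>L2_fourier \<mu> \<nu> f F\<close>: \<open>F\<close> represents (up to null sets) the value at \<open>f\<close> of the extension of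
  \<^const>\<open>fourier\<close> by continuity from the intersection of L1 and L2 to all of L2.
\<close>

definition L2_fourier :: "'a::topological_ab_group_add measure \<Rightarrow> 'a character measure \<Rightarrow>
    ('a \<Rightarrow> complex) \<Rightarrow> ('a character \<Rightarrow> complex) \<Rightarrow> bool" where
  "L2_fourier \<mu> \<nu> f F \<longleftrightarrow> f \<in> L2 \<mu> \<and> F \<in> L2 \<nu> \<and>
     (\<exists>g. (\<forall>n. g n \<in> L1 \<mu> \<inter> L2 \<mu>) \<and> L2_lim \<mu> g f \<and> L2_lim \<nu> (\<lambda>n. fourier \<mu> (g n)) F)"

text \<open>
  The normalization of a pair of Haar measures: the Fourier transform extends to an isometry
  of L2 spaces, whose inverse is \<^const>\<open>inverse_fourier\<close>. The integral defining the latter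
  exists only for integrable functions, so this is required on the dense subspace of functions
  that are also integrable; it then holds on L2 by continuity.
\<close>

definition plancherel_normalized ::
    "'a::topological_ab_group_add measure \<Rightarrow> 'a character measure \<Rightarrow> bool" where
  "plancherel_normalized \<mu> \<nu> \<longleftrightarrow>
     (\<forall>f \<in> L1 \<mu> \<inter> L2 \<mu>. fourier \<mu> f \<in> L2 \<nu> \<and> L2_norm \<nu> (fourier \<mu> f) = L2_norm \<mu> f) \<and>
     (\<forall>F \<in> L1 \<nu> \<inter> L2 \<nu>. L2_fourier \<mu> \<nu> (inverse_fourier \<nu> F) F)"


section \<open>The space of functions with Fourier transform supported on a set\<close>

text \<open>
  Elements are honest functions, namely the continuous representatives; two elements that
  agree almost everywhere are equal.
\<close>

definition H_space :: "'a::topological_ab_group_add measure \<Rightarrow> 'a character measure \<Rightarrow>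
    'a character set \<Rightarrow> ('a \<Rightarrow> complex) set" where
  "H_space \<mu> \<nu> D = {f. \<exists>F. L2_fourier \<mu> \<nu> f F \<and> (AE \<xi> in \<nu>. \<xi> \<notin> D \<longrightarrow> F \<xi> = 0) \<and>
     (\<forall>x. f x = (LINT \<xi>:D|\<nu>. F \<xi> * chr \<xi> x))}"

definition g_fun :: "'a::topological_ab_group_add character measure \<Rightarrow> 'a character set \<Rightarrow> 'a \<Rightarrow> complex" where
  "g_fun \<nu> D x = (LINT \<xi>:D|\<nu>. chr \<xi> x)"

definition coherent_state :: "'a::topological_ab_group_add character measure \<Rightarrow> 'a character set \<Rightarrow>
    'a \<Rightarrow> 'a \<Rightarrow> complex" where
  "coherent_state \<nu> D x = (\<lambda>y. g_fun \<nu> D (y - x))"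


section \<open>Frames and operators\<close>

definition is_frame :: "'a measure \<Rightarrow> ('a \<Rightarrow> complex) set \<Rightarrow> (nat \<Rightarrow> 'a \<Rightarrow> complex) \<Rightarrow> bool" where
  "is_frame M H \<phi> \<longleftrightarrow> (\<exists>A B. 0 < A \<and> A \<le> B \<and> (\<forall>f\<in>H.
     summable (\<lambda>j. (norm (L2_inner M f (\<phi> j)))\<^sup>2) \<and>
     A * (L2_norm M f)\<^sup>2 \<le> (\<Sum>j. (norm (L2_inner M f (\<phi> j)))\<^sup>2) \<and>
     (\<Sum>j. (norm (L2_inner M f (\<phi> j)))\<^sup>2) \<le> B * (L2_norm M f)\<^sup>2))"

text \<open>
  The following notions are for a linear subspace \<open>H\<close> of L2 in which functions equal almost
  everywhere are equal, such as \<^const>\<open>H_space\<close>.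
\<close>

definition bounded_operator_on ::
    "'a measure \<Rightarrow> ('a \<Rightarrow> complex) set \<Rightarrow> (('a \<Rightarrow> complex) \<Rightarrow> ('a \<Rightarrow> complex)) \<Rightarrow> bool" where
  "bounded_operator_on M H T \<longleftrightarrow>
     T ` H \<subseteq> H \<and>
     (\<forall>f\<in>H. \<forall>g\<in>H. T (\<lambda>x. f x + g x) = (\<lambda>x. T f x + T g x)) \<and>
     (\<forall>f\<in>H. \<forall>c. T (\<lambda>x. c * f x) = (\<lambda>x. c * T f x)) \<and>
     (\<exists>C. \<forall>f\<in>H. L2_norm M (T f) \<le> C * L2_norm M f)"

definition positive_operator_on ::
    "'a measure \<Rightarrow> ('a \<Rightarrow> complex) set \<Rightarrow> (('a \<Rightarrow> complex) \<Rightarrow> ('a \<Rightarrow> complex)) \<Rightarrow> bool" where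
  "positive_operator_on M H T \<longleftrightarrow> (\<forall>f\<in>H. L2_inner M (T f) f \<in> \<real>\<^sub>\<ge>\<^sub>0)"

definition invertible_operator_on ::
    "'a measure \<Rightarrow> ('a \<Rightarrow> complex) set \<Rightarrow> (('a \<Rightarrow> complex) \<Rightarrow> ('a \<Rightarrow> complex)) \<Rightarrow> bool" where
  "invertible_operator_on M H T \<longleftrightarrow> bij_betw T H H \<and> bounded_operator_on M H (inv_into H T)"

text \<open>
  \<open>S(f)\<close> is the element of \<^const>\<open>H_space\<close> that is the norm limit of the series of
  \<open>f (y j)\<close> times the coherent state at \<open>y j\<close>; the description is meaningful only once the
  series is known to converge.
\<close>

definition frame_operator :: "'a::topological_ab_group_add measure \<Rightarrow> 'a character measure \<Rightarrow>
    'a character set \<Rightarrow> (nat \<Rightarrow> 'a) \<Rightarrow> ('a \<Rightarrow> complex) \<Rightarrow> ('a \<Rightarrow> complex)" where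
  "frame_operator \<mu> \<nu> D y f = (THE h. h \<in> H_space \<mu> \<nu> D \<and>
     L2_lim \<mu> (\<lambda>n x. \<Sum>j<n. f (y j) * coherent_state \<nu> D (y j) x) h)"

end

theory Submission
  imports Defs "HOL-Library.Function_Algebras"
begin

text \<open>
  The inverse Fourier transform maps the square-integrable functions vanishing off \<open>D\<close>
  isometrically onto \<open>H_space \<mu> \<nu> D\<close>, so this is a Hilbert space (completeness is the
  Riesz--Fischer theorem on the dual group) in which the coherent states are reproducing vectors
  of constant norm. The frame inequalities make the frame operator \<open>S\<close> bounded, self-adjoint and
  coercive, hence invertible. Applying \<open>S\<inverse>\<close> to the series for \<open>S f\<close> gives the reconstruction
  series with convergence in norm; norms dominate suprema because the coherent states have constant
  norm, so the convergence is even uniform on the whole group. Absolute convergence holds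
  because \<open>(S\<inverse> \<phi>\<^sub>j)(x)\<close> is the conjugate of \<open>\<langle>S\<inverse> \<phi>\<^sub>x | \<phi>\<^sub>j\<rangle>\<close>, so that both factors of
  the summand are square-summable in \<open>j\<close>.
\<close>

section \<open>Frames in abstract Hilbert spaces\<close>

lemma norm_mult_le_sum_squares:
  fixes a b :: complex
  shows "norm (a * b) \<le> (norm a)\<^sup>2 + (norm b)\<^sup>2"
proof -
  have "0 \<le> norm a * norm b" by simp
  then show ?thesis
    using sum_squares_bound[of "norm a" "norm b"] by (simp add: norm_mult del: mult_nonneg_nonneg)
qed

text \<open>Vectors live in an ambient type and \<open>H\<close> is a carrier set, since the spaces
  in question are sets of functions. The form is only semidefinite, so that the locale covers
  \<open>L2 M\<close>, whose null functions are not identified with 0.\<close>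

locale semi_inner_space = vector_space scale
  for scale :: "complex \<Rightarrow> 'v::ab_group_add \<Rightarrow> 'v" (infixr "*\<^sub>C" 75) +
  fixes H :: "'v set" and ip :: "'v \<Rightarrow> 'v \<Rightarrow> complex"
  assumes subspace_H: "subspace H"
    and ip_add_left: "f \<in> H \<Longrightarrow> g \<in> H \<Longrightarrow> h \<in> H \<Longrightarrow> ip (f + g) h = ip f h + ip g h"
    and ip_scale_left: "f \<in> H \<Longrightarrow> g \<in> H \<Longrightarrow> ip (c *\<^sub>C f) g = c * ip f g"
    and ip_commute: "f \<in> H \<Longrightarrow> g \<in> H \<Longrightarrow> ip g f = cnj (ip f g)"
    and Re_ip_ge_0: "f \<in> H \<Longrightarrow> 0 \<le> Re (ip f f)"
begin

definition nrm :: "'v \<Rightarrow> real" where "nrm f = sqrt (Re (ip f f))"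

lemmas H_zero [simp] = subspace_0[OF subspace_H]
  and H_add [simp] = subspace_add[OF subspace_H]
  and H_diff [simp] = subspace_diff[OF subspace_H]
  and H_scale [simp] = subspace_scale[OF subspace_H]
  and H_sum = subspace_sum[OF subspace_H]

lemma ip_zero_left [simp]: "g \<in> H \<Longrightarrow> ip 0 g = 0"
  using ip_scale_left[of 0 g 0] by simp

lemma ip_diff_left: "f \<in> H \<Longrightarrow> g \<in> H \<Longrightarrow> h \<in> H \<Longrightarrow> ip (f - g) h = ip f h - ip g h"
  using ip_add_left[of "f - g" g h] by simp

lemma ip_add_right: "f \<in> H \<Longrightarrow> g \<in> H \<Longrightarrow> h \<in> H \<Longrightarrow> ip f (g + h) = ip f g + ip f h"
  using ip_commute[of "g + h" f] ip_commute[of g f] ip_commute[of h f] by (simp add: ip_add_left)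

lemma ip_diff_right: "f \<in> H \<Longrightarrow> g \<in> H \<Longrightarrow> h \<in> H \<Longrightarrow> ip f (g - h) = ip f g - ip f h"
  using ip_commute[of "g - h" f] ip_commute[of g f] ip_commute[of h f] by (simp add: ip_diff_left)

lemma ip_scale_right: "f \<in> H \<Longrightarrow> g \<in> H \<Longrightarrow> ip f (c *\<^sub>C g) = cnj c * ip f g"
  using ip_commute[of "c *\<^sub>C g" f] ip_commute[of g f] by (simp add: ip_scale_left)

lemma ip_sum_left:
  assumes "\<And>j. j \<in> J \<Longrightarrow> f j \<in> H" "g \<in> H"
  shows "ip (\<Sum>j\<in>J. f j) g = (\<Sum>j\<in>J. ip (f j) g)"
  using assms(1)
  by (induction J rule: infinite_finite_induct) (auto simp: ip_add_left assms(2) H_sum)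

lemma nrm_ge_0 [simp]: "f \<in> H \<Longrightarrow> 0 \<le> nrm f"
  by (simp add: nrm_def Re_ip_ge_0)

lemma nrm_power2: "f \<in> H \<Longrightarrow> (nrm f)\<^sup>2 = Re (ip f f)"
  by (simp add: nrm_def Re_ip_ge_0)

lemma ip_self: "f \<in> H \<Longrightarrow> ip f f = of_real ((nrm f)\<^sup>2)"
  using ip_commute[of f f] by (simp add: nrm_power2 complex_eq_iff)

lemma nrm_zero [simp]: "nrm 0 = 0"
  by (simp add: nrm_def)

lemma nrm_scale [simp]: "f \<in> H \<Longrightarrow> nrm (c *\<^sub>C f) = norm c * nrm f"
proof -
  assume f: "f \<in> H"
  have "ip (c *\<^sub>C f) (c *\<^sub>C f) = of_real ((norm c)\<^sup>2) * ip f f"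
    using f by (simp only: ip_scale_left ip_scale_right H_scale complex_norm_square) (simp add: ac_simps)
  then have "(nrm (c *\<^sub>C f))\<^sup>2 = (norm c * nrm f)\<^sup>2"
    using f by (simp add: nrm_power2 power_mult_distrib)
  then show ?thesis
    using f by (simp add: power2_eq_iff_nonneg)
qed

lemma nrm_add_power2:
  "f \<in> H \<Longrightarrow> g \<in> H \<Longrightarrow> (nrm (f + g))\<^sup>2 = (nrm f)\<^sup>2 + 2 * Re (ip f g) + (nrm g)\<^sup>2"
  using ip_commute[of f g] by (simp add: nrm_power2 ip_add_left ip_add_right)

lemma nrm_diff_power2:
  "f \<in> H \<Longrightarrow> g \<in> H \<Longrightarrow> (nrm (f - g))\<^sup>2 = (nrm f)\<^sup>2 - 2 * Re (ip f g) + (nrm g)\<^sup>2"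
  using ip_commute[of f g] by (simp add: nrm_power2 ip_diff_left ip_diff_right)

lemma nrm_minus_commute: "f \<in> H \<Longrightarrow> g \<in> H \<Longrightarrow> nrm (f - g) = nrm (g - f)"
  using nrm_scale[of "f - g" "-1"] by simp

text \<open>Expand the squared norm of f - t <f,g> g, which is nonnegative for every real t. As the
  form is only semidefinite, \<open>nrm g = 0\<close> gets its own choice of t.\<close>

lemma Cauchy_Schwarz:
  assumes f: "f \<in> H" and g: "g \<in> H"
  shows "norm (ip f g) \<le> nrm f * nrm g"
proof -
  define u where "u = norm (ip f g)"
  have quadratic: "0 \<le> (nrm f)\<^sup>2 - 2 * t * u\<^sup>2 + t\<^sup>2 * u\<^sup>2 * (nrm g)\<^sup>2" for t
  proof -
    have "ip f ((of_real t * ip f g) *\<^sub>C g) = of_real t * of_real (u\<^sup>2)"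
      unfolding u_def using f g by (simp only: ip_scale_right complex_norm_square) (simp add: ac_simps)
    then have "Re (ip f ((of_real t * ip f g) *\<^sub>C g)) = t * u\<^sup>2"
      by (metis Re_complex_of_real of_real_mult)
    moreover have "(nrm ((of_real t * ip f g) *\<^sub>C g))\<^sup>2 = t\<^sup>2 * u\<^sup>2 * (nrm g)\<^sup>2"
      using g by (simp add: norm_mult power_mult_distrib u_def)
    ultimately show ?thesis
      using nrm_diff_power2[of f "(of_real t * ip f g) *\<^sub>C g"] f g
        zero_le_power2[of "nrm (f - (of_real t * ip f g) *\<^sub>C g)"] by simp
  qed
  have "u\<^sup>2 \<le> (nrm f * nrm g)\<^sup>2"
  proof (cases "u = 0")
    case False
    then have u: "u\<^sup>2 > 0" by simp
    show ?thesis
    proof (cases "nrm g = 0")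
      case True
      \<comment> \<open>Here the quadratic is affine in \<open>t\<close>, and this value makes it
        equal to -1.\<close>
      with quadratic[of "((nrm f)\<^sup>2 + 1) / (2 * u\<^sup>2)"] u show ?thesis
        by (simp add: field_simps)
    next
      case False
      \<comment> \<open>The quadratic attains its minimum at t = 1 / |g|^2.\<close>
      then have "0 \<le> (nrm f)\<^sup>2 - u\<^sup>2 / (nrm g)\<^sup>2"
        using quadratic[of "1 / (nrm g)\<^sup>2"] by (simp add: field_simps power2_eq_square)
      then show ?thesis
        using False by (simp add: field_simps power_mult_distrib)
    qed
  qed simp
  then show ?thesis
    unfolding u_def using f g by (simp add: power2_le_iff_abs_le)
qed

lemma nrm_triangle:
  assumes "f \<in> H" "g \<in> H"
  shows "nrm (f + g) \<le> nrm f + nrm g"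
proof (rule power2_le_imp_le)
  have "Re (ip f g) \<le> nrm f * nrm g"
    using Cauchy_Schwarz[OF assms] complex_Re_le_cmod[of "ip f g"] by linarith
  then show "(nrm (f + g))\<^sup>2 \<le> (nrm f + nrm g)\<^sup>2"
    using assms by (simp add: nrm_add_power2 power2_sum)
qed (use assms in simp)

lemma nrm_triangle_diff:
  assumes "f \<in> H" "g \<in> H" "h \<in> H"
  shows "nrm (f - h) \<le> nrm (f - g) + nrm (g - h)"
  using nrm_triangle[of "f - g" "g - h"] assms by simp

lemma nrm_reverse_triangle:
  assumes "f \<in> H" "g \<in> H"
  shows "\<bar>nrm f - nrm g\<bar> \<le> nrm (f - g)"
  using nrm_triangle[of "f - g" g] nrm_triangle[of "g - f" f] nrm_minus_commute assms
  by (simp add: abs_le_iff)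

lemma tendsto_nrm:
  assumes "\<And>n. u n \<in> H" "h \<in> H" "(\<lambda>n. nrm (u n - h)) \<longlonglongrightarrow> 0"
  shows "(\<lambda>n. nrm (u n)) \<longlonglongrightarrow> nrm h"
proof -
  have "(\<lambda>n. nrm (u n) - nrm h) \<longlonglongrightarrow> 0"
    by (rule Lim_null_comparison[OF _ assms(3)]) (simp add: assms nrm_reverse_triangle)
  then show ?thesis by (simp add: LIM_zero_iff)
qed

lemma tendsto_ip_left:
  assumes "\<And>n. u n \<in> H" "h \<in> H" "g \<in> H" "(\<lambda>n. nrm (u n - h)) \<longlonglongrightarrow> 0"
  shows "(\<lambda>n. ip (u n) g) \<longlonglongrightarrow> ip h g"
proof -
  have "(\<lambda>n. ip (u n) g - ip h g) \<longlonglongrightarrow> 0"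
  proof (rule Lim_null_comparison)
    show "\<forall>\<^sub>F n in sequentially. norm (ip (u n) g - ip h g) \<le> nrm (u n - h) * nrm g"
      using Cauchy_Schwarz[of "u _ - h" g] assms by (simp add: ip_diff_left)
    show "(\<lambda>n. nrm (u n - h) * nrm g) \<longlonglongrightarrow> 0"
      using tendsto_mult_left_zero[OF assms(4)] by simp
  qed
  then show ?thesis by (simp add: LIM_zero_iff)
qed

end

section \<open>Hilbert spaces: unique limits and fixed points\<close>

locale hilbert_carrier = semi_inner_space +
  assumes nrm_eq_0_imp: "f \<in> H \<Longrightarrow> nrm f = 0 \<Longrightarrow> f = 0"
    and complete: "(\<And>n. u n \<in> H) \<Longrightarrow>
      (\<And>e. e > 0 \<Longrightarrow> \<exists>N. \<forall>m\<ge>N. \<forall>n\<ge>N. nrm (u m - u n) < e) \<Longrightarrow>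
      \<exists>h\<in>H. (\<lambda>n. nrm (u n - h)) \<longlonglongrightarrow> 0"
begin

lemma nrm_eq_0_iff: "f \<in> H \<Longrightarrow> nrm f = 0 \<longleftrightarrow> f = 0"
  using nrm_eq_0_imp by auto

lemma limit_unique:
  assumes "\<And>n. u n \<in> H" "h \<in> H" "k \<in> H"
    and "(\<lambda>n. nrm (u n - h)) \<longlonglongrightarrow> 0" "(\<lambda>n. nrm (u n - k)) \<longlonglongrightarrow> 0"
  shows "h = k"
proof -
  have "(\<lambda>n. nrm (u n - h) + nrm (u n - k)) \<longlonglongrightarrow> 0"
    using tendsto_add[OF assms(4,5)] by simp
  then have "(\<lambda>n. nrm (h - k)) \<longlonglongrightarrow> 0"
  proof (rule Lim_null_comparison[rotated])
    show "\<forall>\<^sub>F n in sequentially. norm (nrm (h - k)) \<le> nrm (u n - h) + nrm (u n - k)"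
      using nrm_triangle_diff[of h "u _" k] nrm_minus_commute[of h "u _"] assms by simp
  qed
  then have "nrm (h - k) = 0" by (simp add: LIMSEQ_const_iff)
  then show ?thesis using nrm_eq_0_iff[of "h - k"] assms by simp
qed

text \<open>Banach's fixed-point theorem for \<open>H\<close> with the norm distance; it will give
  surjectivity of the frame operator.\<close>

lemma contraction_fixed_point:
  assumes T: "\<And>f. f \<in> H \<Longrightarrow> T f \<in> H" and q: "q < 1"
    and lip: "\<And>f g. f \<in> H \<Longrightarrow> g \<in> H \<Longrightarrow> nrm (T f - T g) \<le> q * nrm (f - g)"
  shows "\<exists>f\<in>H. T f = f"
proof -
  \<comment> \<open>A metric must be nonnegative and symmetric for all arguments, so
    \<open>d\<close> is set to 0 off \<open>H\<close>, where nothing is known about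
    \<open>nrm\<close>.\<close>
  define d where "d f g = (if f \<in> H \<and> g \<in> H then nrm (f - g) else 0)" for f g
  interpret MS: Metric_space H d
    by standard (auto simp: d_def nrm_minus_commute nrm_eq_0_iff nrm_triangle_diff)
  have MS.mcomplete
    unfolding MS.mcomplete_def
  proof (intro allI impI)
    fix u assume "MS.MCauchy u"
    then have u: "\<And>n. u n \<in> H" "\<And>e. e > 0 \<Longrightarrow> \<exists>N. \<forall>m\<ge>N. \<forall>n\<ge>N. nrm (u m - u n) < e"
      unfolding MS.MCauchy_def d_def by (auto simp: image_subset_iff)
    obtain h where "h \<in> H" "(\<lambda>n. nrm (u n - h)) \<longlonglongrightarrow> 0"
      using complete[OF u] by blast
    then show "\<exists>h. limitin MS.mtopology u h sequentially"
      unfolding MS.limitin_metric_dist_null using u(1) by (auto simp: d_def intro!: exI[of _ h])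
  qed
  moreover have "H \<noteq> {}" "T \<in> H \<rightarrow> H"
    using H_zero T by blast+
  moreover have "d (T f) (T g) \<le> q * d f g" if "f \<in> H" "g \<in> H" for f g
    using lip that T by (simp add: d_def)
  ultimately show ?thesis
    using MS.Banach_fixedpoint_thm[OF _ _ _ q, where f = T and thesis = "\<exists>f\<in>H. T f = f"] by fast
qed

text \<open>Pairing with \<open>f - g\<close> shows that its norm is zero. Linearity of the frame
  operator is proved this way from the series for its inner products.\<close>

lemma ip_ext:
  assumes "f \<in> H" "g \<in> H" "\<And>h. h \<in> H \<Longrightarrow> ip f h = ip g h"
  shows "f = g"
proof -
  have "nrm (f - g) = 0"
    using assms by (simp add: nrm_def ip_diff_left)
  then show ?thesis using nrm_eq_0_iff[of "f - g"] assms by simp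
qed

end

section \<open>Frames and the convergence of synthesis series\<close>

locale hilbert_frame = hilbert_carrier scale H ip
  for scale :: "complex \<Rightarrow> 'v::ab_group_add \<Rightarrow> 'v" (infixr "*\<^sub>C" 75) and H ip +
  fixes \<phi> :: "nat \<Rightarrow> 'v" and A B :: real
  assumes frame_in_H [simp]: "\<phi> j \<in> H"
    and A_pos: "0 < A" and A_le_B: "A \<le> B"
    and frame_summable: "f \<in> H \<Longrightarrow> summable (\<lambda>j. (norm (ip f (\<phi> j)))\<^sup>2)"
    and frame_lower: "f \<in> H \<Longrightarrow> A * (nrm f)\<^sup>2 \<le> (\<Sum>j. (norm (ip f (\<phi> j)))\<^sup>2)"
    and frame_upper: "f \<in> H \<Longrightarrow> (\<Sum>j. (norm (ip f (\<phi> j)))\<^sup>2) \<le> B * (nrm f)\<^sup>2"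
begin

lemma B_pos: "0 < B"
  using A_pos A_le_B by simp

lemma synthesis_in_H [simp]: "(\<Sum>j\<in>J. c j *\<^sub>C \<phi> j) \<in> H"
  by (rule H_sum) simp

text \<open>Synthesis is adjoint to analysis and inherits its bound: with |v|^2 = <v,v> expanded as
  a sum over \<open>J\<close>, Cauchy-Schwarz for finite sums and the upper frame bound give |v|^4
  \<le> a B |v|^2.\<close>

lemma synthesis_bound:
  assumes "finite J"
  shows "(nrm (\<Sum>j\<in>J. c j *\<^sub>C \<phi> j))\<^sup>2 \<le> B * (\<Sum>j\<in>J. (norm (c j))\<^sup>2)"
proof -
  define v where "v = (\<Sum>j\<in>J. c j *\<^sub>C \<phi> j)"
  define a where "a = (\<Sum>j\<in>J. (norm (c j))\<^sup>2)"
  have v: "v \<in> H" by (simp add: v_def)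
  have ip_sym: "norm (ip (\<phi> j) v) = norm (ip v (\<phi> j))" for j
    using ip_commute[of v "\<phi> j"] v by simp
  have "(nrm v)\<^sup>2 = norm (ip v v)"
    using ip_self[OF v] by (simp only: norm_of_real) simp
  also have "ip v v = (\<Sum>j\<in>J. c j * ip (\<phi> j) v)"
    by (subst v_def) (simp add: ip_sum_left v ip_scale_left)
  also have "norm \<dots> \<le> (\<Sum>j\<in>J. norm (c j) * norm (ip v (\<phi> j)))"
    by (rule order_trans[OF norm_sum]) (simp add: norm_mult ip_sym)
  finally have "((nrm v)\<^sup>2)\<^sup>2 \<le> (\<Sum>j\<in>J. norm (c j) * norm (ip v (\<phi> j)))\<^sup>2"
    by (rule power_mono) simp
  also have "\<dots> \<le> a * (\<Sum>j\<in>J. (norm (ip v (\<phi> j)))\<^sup>2)"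
    unfolding a_def by (rule Cauchy_Schwarz_ineq_sum)
  also have "\<dots> \<le> a * (B * (nrm v)\<^sup>2)"
    using sum_le_suminf[OF frame_summable[OF v] assms] frame_upper[OF v]
    by (intro mult_left_mono) (auto simp: a_def intro: sum_nonneg)
  finally have "(nrm v)\<^sup>2 * (nrm v)\<^sup>2 \<le> (B * a) * (nrm v)\<^sup>2"
    by (simp add: power2_eq_square ac_simps)
  moreover have "0 \<le> B * a"
    using B_pos by (simp add: a_def sum_nonneg)
  \<comment> \<open>The factor |v|^2 is cancelled; if it vanishes, \<open>0 \<le> B * a\<close>
    suffices.\<close>
  ultimately have "(nrm v)\<^sup>2 \<le> B * a"
    using mult_right_le_imp_le[of "(nrm v)\<^sup>2" "(nrm v)\<^sup>2" "B * a"] by (cases "nrm v = 0") auto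
  then show ?thesis by (simp add: v_def a_def)
qed

text \<open>Partial sums differ by finite blocks, to which \<open>synthesis_bound\<close> applies,
  so they are Cauchy along with the sums of the squared coefficients.\<close>

lemma synthesis_converges:
  assumes c: "summable (\<lambda>j. (norm (c j))\<^sup>2)"
  shows "\<exists>h\<in>H. (\<lambda>n. nrm ((\<Sum>j<n. c j *\<^sub>C \<phi> j) - h)) \<longlonglongrightarrow> 0"
proof (rule complete)
  fix e :: real assume e: "e > 0"
  let ?u = "\<lambda>n. \<Sum>j<n. c j *\<^sub>C \<phi> j"
  \<comment> \<open>The threshold e^2 / B compensates the factor \<open>B\<close> in
    \<open>synthesis_bound\<close>.\<close>
  obtain N where N: "\<And>m n. m \<ge> N \<Longrightarrow> norm (\<Sum>j=m..<n. (norm (c j))\<^sup>2) < e\<^sup>2 / B"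
    using c e B_pos unfolding summable_Cauchy by (meson divide_pos_pos zero_less_power)
  have less: "nrm (?u n - ?u m) < e" if "N \<le> m" "m \<le> n" for m n
  proof (rule power2_less_imp_less)
    have "?u n - ?u m = (\<Sum>j=m..<n. c j *\<^sub>C \<phi> j)"
      using \<open>m \<le> n\<close> sum_diff_nat_ivl[of 0 m n "\<lambda>j. c j *\<^sub>C \<phi> j"] by (simp add: atLeast0LessThan)
    then have "(nrm (?u n - ?u m))\<^sup>2 \<le> B * (\<Sum>j=m..<n. (norm (c j))\<^sup>2)"
      using synthesis_bound by simp
    also have "\<dots> < e\<^sup>2"
      using N[OF that(1), of n] B_pos by (simp add: sum_nonneg field_simps)
    finally show "(nrm (?u n - ?u m))\<^sup>2 < e\<^sup>2" .
  qed (use e in simp)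
  have "nrm (?u m - ?u n) < e" if "N \<le> m" "N \<le> n" for m n
    using less[of m n] less[of n m] that nrm_minus_commute[of "?u m" "?u n"]
    by (cases "m \<le> n") auto
  then show "\<exists>N. \<forall>m\<ge>N. \<forall>n\<ge>N. nrm (?u m - ?u n) < e" by blast
qed simp

section \<open>The frame operator: linearity, bounds and bijectivity\<close>

definition frame_op :: "'v \<Rightarrow> 'v" where
  "frame_op f = (THE h. h \<in> H \<and> (\<lambda>n. nrm ((\<Sum>j<n. ip f (\<phi> j) *\<^sub>C \<phi> j) - h)) \<longlonglongrightarrow> 0)"

text \<open>Frame coefficients are square-summable, so the series has a limit, and
  \<open>limit_unique\<close> makes the description proper.\<close>

lemma frame_op:
  assumes "f \<in> H"
  shows frame_op_in_H [simp]: "frame_op f \<in> H"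
    and frame_op_limit: "(\<lambda>n. nrm ((\<Sum>j<n. ip f (\<phi> j) *\<^sub>C \<phi> j) - frame_op f)) \<longlonglongrightarrow> 0"
proof -
  let ?P = "\<lambda>h. h \<in> H \<and> (\<lambda>n. nrm ((\<Sum>j<n. ip f (\<phi> j) *\<^sub>C \<phi> j) - h)) \<longlonglongrightarrow> 0"
  obtain h where h: "?P h"
    using synthesis_converges[OF frame_summable[OF assms]] by blast
  moreover have "k = h" if "?P k" for k
    by (rule limit_unique[of "\<lambda>n. \<Sum>j<n. ip f (\<phi> j) *\<^sub>C \<phi> j"]) (use that h in auto)
  ultimately have "?P (frame_op f)"
    unfolding frame_op_def by (rule theI)
  then show "frame_op f \<in> H" "(\<lambda>n. nrm ((\<Sum>j<n. ip f (\<phi> j) *\<^sub>C \<phi> j) - frame_op f)) \<longlonglongrightarrow> 0"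
    by auto
qed

text \<open>Continuity of the inner product in its first argument. The series is Hermitian in
  \<open>f\<close> and \<open>g\<close>, so linearity, positivity and self-adjointness of the
  operator can all be read off from it.\<close>

lemma ip_frame_op:
  assumes "f \<in> H" "g \<in> H"
  shows "(\<lambda>j. ip f (\<phi> j) * cnj (ip g (\<phi> j))) sums ip (frame_op f) g"
proof -
  have "(\<lambda>n. ip (\<Sum>j<n. ip f (\<phi> j) *\<^sub>C \<phi> j) g) \<longlonglongrightarrow> ip (frame_op f) g"
    using assms by (intro tendsto_ip_left frame_op_limit) auto
  moreover have "ip (\<phi> j) g = cnj (ip g (\<phi> j))" for j
    using assms by (simp add: ip_commute[of g])
  ultimately show ?thesis
    using assms by (simp add: sums_def ip_sum_left ip_scale_left)
qed

lemma frame_op_add: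
  assumes "f \<in> H" "g \<in> H"
  shows "frame_op (f + g) = frame_op f + frame_op g"
proof (rule ip_ext)
  fix h assume h: "h \<in> H"
  have "(\<lambda>j. ip (f + g) (\<phi> j) * cnj (ip h (\<phi> j))) sums (ip (frame_op f) h + ip (frame_op g) h)"
    using sums_add[OF ip_frame_op[OF assms(1) h] ip_frame_op[OF assms(2) h]] assms
    by (simp add: ip_add_left algebra_simps)
  then show "ip (frame_op (f + g)) h = ip (frame_op f + frame_op g) h"
    using ip_frame_op[of "f + g" h] assms h by (simp add: ip_add_left sums_unique2)
qed (use assms in auto)

lemma frame_op_scale:
  assumes "f \<in> H"
  shows "frame_op (c *\<^sub>C f) = c *\<^sub>C frame_op f"
proof (rule ip_ext)
  fix h assume h: "h \<in> H"
  have "(\<lambda>j. ip (c *\<^sub>C f) (\<phi> j) * cnj (ip h (\<phi> j))) sums (c * ip (frame_op f) h)"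
    using sums_mult[OF ip_frame_op[OF assms h], of c] assms by (simp add: ip_scale_left ac_simps)
  then show "ip (frame_op (c *\<^sub>C f)) h = ip (c *\<^sub>C frame_op f) h"
    using ip_frame_op[of "c *\<^sub>C f" h] assms h by (simp add: ip_scale_left sums_unique2)
qed (use assms in auto)

lemma frame_op_diff:
  "f \<in> H \<Longrightarrow> g \<in> H \<Longrightarrow> frame_op (f - g) = frame_op f - frame_op g"
  using frame_op_add[of "f - g" g] by (simp add: eq_diff_eq)

lemma frame_op_self:
  assumes "f \<in> H"
  shows "ip (frame_op f) f = of_real (\<Sum>j. (norm (ip f (\<phi> j)))\<^sup>2)"
proof -
  have "(\<lambda>j. of_real ((norm (ip f (\<phi> j)))\<^sup>2) :: complex) sums of_real (\<Sum>j. (norm (ip f (\<phi> j)))\<^sup>2)"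
    using frame_summable[OF assms] by (intro sums_of_real) (simp add: summable_sums)
  then show ?thesis
    using ip_frame_op[OF assms assms] by (simp only: complex_norm_square sums_unique2)
qed

lemma frame_op_coercive: "f \<in> H \<Longrightarrow> A * (nrm f)\<^sup>2 \<le> Re (ip (frame_op f) f)"
  by (simp add: frame_op_self frame_lower)

text \<open>One factor sqrt B comes from synthesis, the other from the upper frame bound on the
  coefficients; the estimate for partial sums passes to the limit.\<close>

lemma frame_op_bounded:
  assumes f: "f \<in> H"
  shows "nrm (frame_op f) \<le> B * nrm f"
proof (rule LIMSEQ_le_const2)
  let ?u = "\<lambda>n. \<Sum>j<n. ip f (\<phi> j) *\<^sub>C \<phi> j"
  show "(\<lambda>n. nrm (?u n)) \<longlonglongrightarrow> nrm (frame_op f)"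
    using f by (intro tendsto_nrm frame_op_limit) auto
  have "nrm (?u n) \<le> B * nrm f" for n
  proof (rule power2_le_imp_le)
    have "(nrm (?u n))\<^sup>2 \<le> B * (\<Sum>j<n. (norm (ip f (\<phi> j)))\<^sup>2)"
      by (rule synthesis_bound) simp
    also have "\<dots> \<le> B * (B * (nrm f)\<^sup>2)"
      using sum_le_suminf[OF frame_summable[OF f], of "{..<n}"] frame_upper[OF f] B_pos
      by (intro mult_left_mono) auto
    finally show "(nrm (?u n))\<^sup>2 \<le> (B * nrm f)\<^sup>2"
      by (simp add: power2_eq_square ac_simps)
  qed (use f B_pos in simp)
  then show "\<exists>N. \<forall>n\<ge>N. nrm (?u n) \<le> B * nrm f" by blast
qed

text \<open>Coercivity against Cauchy-Schwarz, divided by |f|. This gives injectivity and the bound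
  1 / A for the inverse.\<close>

lemma frame_op_bounded_below:
  assumes f: "f \<in> H"
  shows "A * nrm f \<le> nrm (frame_op f)"
proof (cases "nrm f = 0")
  case False
  have "A * (nrm f)\<^sup>2 \<le> nrm (frame_op f) * nrm f"
    using frame_op_coercive[OF f] Cauchy_Schwarz[of "frame_op f" f] f
      complex_Re_le_cmod[of "ip (frame_op f) f"] by simp
  then show ?thesis
    using False f nrm_ge_0[OF f] by (simp add: power2_eq_square)
qed (use f in simp)

text \<open>With \<open>t = A / B\<^sup>2\<close>, the map \<open>u \<mapsto> u - t (S u - h)\<close> is a contraction, because
  \<open>1 - 2 t A + t\<^sup>2 B\<^sup>2 = 1 - A\<^sup>2 / B\<^sup>2\<close>.\<close>

lemma frame_op_surj:
  assumes h: "h \<in> H"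
  shows "\<exists>f\<in>H. frame_op f = h"
proof -
  define t where "t = A / B\<^sup>2"
  define q where "q = sqrt (1 - (A / B)\<^sup>2)"
  define T where "T u = u - complex_of_real t *\<^sub>C (frame_op u - h)" for u
  have t: "t > 0" using A_pos B_pos by (simp add: t_def)
  \<comment> \<open>The first bound makes \<open>q\<close> the root of a nonnegative number, the
    second makes \<open>q < 1\<close>.\<close>
  have q1: "(A / B)\<^sup>2 \<le> 1" "0 < (A / B)\<^sup>2"
    using A_pos A_le_B by (simp_all add: power_le_one)
  have "nrm (T u - T v) \<le> q * nrm (u - v)" if uv: "u \<in> H" "v \<in> H" for u v
  proof (rule power2_le_imp_le)
    define w where "w = u - v"
    have w: "w \<in> H" using uv by (simp add: w_def)
    have "T u - T v = w - complex_of_real t *\<^sub>C frame_op w"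
      using uv by (simp add: T_def w_def frame_op_diff scale_right_diff_distrib)
    then have "(nrm (T u - T v))\<^sup>2 =
        (nrm w)\<^sup>2 - 2 * (t * Re (ip w (frame_op w))) + t\<^sup>2 * (nrm (frame_op w))\<^sup>2"
      using w by (simp add: nrm_diff_power2 ip_scale_right power_mult_distrib)
    also have "Re (ip w (frame_op w)) = Re (ip (frame_op w) w)"
      using ip_commute[of w "frame_op w"] w by simp
    \<comment> \<open>Coercivity estimates the cross term, boundedness the quadratic term.\<close>
    also have "(nrm w)\<^sup>2 - 2 * (t * Re (ip (frame_op w) w)) + t\<^sup>2 * (nrm (frame_op w))\<^sup>2
        \<le> (nrm w)\<^sup>2 - 2 * (t * (A * (nrm w)\<^sup>2)) + t\<^sup>2 * (B * nrm w)\<^sup>2"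
      using frame_op_coercive[OF w] frame_op_bounded[OF w] t w
      by (intro add_mono diff_mono mult_left_mono power_mono) auto
    also have "\<dots> = (1 - (A / B)\<^sup>2) * (nrm w)\<^sup>2"
      using B_pos by (simp add: t_def field_simps power2_eq_square)
    also have "\<dots> = (q * nrm w)\<^sup>2"
      using q1 by (simp add: q_def power_mult_distrib)
    finally show "(nrm (T u - T v))\<^sup>2 \<le> (q * nrm (u - v))\<^sup>2" by (simp add: w_def)
  qed (use q1 uv in \<open>simp add: q_def\<close>)
  moreover have "q < 1" using q1 by (simp add: q_def)
  moreover have "T u \<in> H" if "u \<in> H" for u using that h by (simp add: T_def)
  ultimately obtain f where f: "f \<in> H" "T f = f"
    using contraction_fixed_point[of T q] by blast
  then have "complex_of_real t *\<^sub>C (frame_op f - h) = 0" by (simp add: T_def)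
  then show ?thesis using t f by auto
qed

lemma frame_op_bij: "bij_betw frame_op H H"
  unfolding bij_betw_def
proof
  show "inj_on frame_op H"
  proof (rule inj_onI)
    fix f g assume fg: "f \<in> H" "g \<in> H" "frame_op f = frame_op g"
    then have "A * nrm (f - g) \<le> 0"
      using frame_op_bounded_below[of "f - g"] by (simp add: frame_op_diff)
    then have "nrm (f - g) = 0"
      by (intro antisym) (use A_pos fg in \<open>auto simp: mult_le_0_iff\<close>)
    then show "f = g" using nrm_eq_0_iff[of "f - g"] fg by simp
  qed
qed (use frame_op_surj in auto)

section \<open>The inverse operator and the reconstruction series\<close>

abbreviation frame_inv :: "'v \<Rightarrow> 'v" where "frame_inv \<equiv> inv_into H frame_op"

lemma frame_inv_in_H [simp]: "f \<in> H \<Longrightarrow> frame_inv f \<in> H"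
  using frame_op_bij by (metis bij_betw_def inv_into_into)

lemma frame_op_inv [simp]: "f \<in> H \<Longrightarrow> frame_op (frame_inv f) = f"
  using frame_op_bij by (metis bij_betw_def f_inv_into_f)

lemma frame_inv_op [simp]: "f \<in> H \<Longrightarrow> frame_inv (frame_op f) = f"
  using frame_op_bij by (metis bij_betw_def inv_into_f_f)

text \<open>Reduces each algebraic rule for the inverse to the same rule for
  \<open>frame_op\<close>.\<close>

lemma frame_inv_unique: "g \<in> H \<Longrightarrow> frame_op g = f \<Longrightarrow> frame_inv f = g"
  using frame_inv_op by blast

lemma frame_inv_add: "f \<in> H \<Longrightarrow> g \<in> H \<Longrightarrow> frame_inv (f + g) = frame_inv f + frame_inv g"
  by (rule frame_inv_unique) (simp_all add: frame_op_add)

lemma frame_inv_diff: "f \<in> H \<Longrightarrow> g \<in> H \<Longrightarrow> frame_inv (f - g) = frame_inv f - frame_inv g"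
  by (rule frame_inv_unique) (simp_all add: frame_op_diff)

lemma frame_inv_scale: "f \<in> H \<Longrightarrow> frame_inv (c *\<^sub>C f) = c *\<^sub>C frame_inv f"
  by (rule frame_inv_unique) (simp_all add: frame_op_scale)

lemma frame_inv_zero: "frame_inv 0 = 0"
  using frame_inv_diff[of 0 0] by simp

lemma frame_inv_synthesis:
  "frame_inv (\<Sum>j\<in>J. c j *\<^sub>C \<phi> j) = (\<Sum>j\<in>J. c j *\<^sub>C frame_inv (\<phi> j))"
  by (induction J rule: infinite_finite_induct)
     (simp_all add: frame_inv_zero frame_inv_add frame_inv_scale)

lemma frame_inv_bounded: "f \<in> H \<Longrightarrow> nrm (frame_inv f) \<le> nrm f / A"
  using frame_op_bounded_below[of "frame_inv f"] A_pos by (simp add: field_simps)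

text \<open>Self-adjointness passes to the inverse: if u and v are the preimages of \<open>f\<close>
  and \<open>g\<close>, the series for <S u, v> and <S v, u> are termwise conjugate.\<close>

lemma ip_frame_inv_commute:
  assumes "f \<in> H" "g \<in> H"
  shows "ip (frame_inv f) g = ip f (frame_inv g)"
proof -
  have "(\<lambda>j. cnj (ip (frame_inv f) (\<phi> j) * cnj (ip (frame_inv g) (\<phi> j)))) sums cnj (ip f (frame_inv g))"
    using ip_frame_op[of "frame_inv f" "frame_inv g"] assms by (simp only: sums_cnj) simp
  moreover have "(\<lambda>j. ip (frame_inv g) (\<phi> j) * cnj (ip (frame_inv f) (\<phi> j))) sums ip g (frame_inv f)"
    using ip_frame_op[of "frame_inv g" "frame_inv f"] assms by simp
  ultimately have "cnj (ip f (frame_inv g)) = ip g (frame_inv f)"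
    by (simp add: mult.commute sums_unique2)
  then show ?thesis
    using ip_commute[of g "frame_inv f"] assms by (metis complex_cnj_cnj frame_inv_in_H)
qed

text \<open>The error is the inverse applied to the error of the partial sum for
  \<open>frame_op f\<close>, and the inverse is bounded by 1 / A.\<close>

lemma frame_reconstruction:
  assumes f: "f \<in> H"
  shows "(\<lambda>n. nrm ((\<Sum>j<n. ip f (\<phi> j) *\<^sub>C frame_inv (\<phi> j)) - f)) \<longlonglongrightarrow> 0"
proof (rule Lim_null_comparison)
  let ?u = "\<lambda>n. \<Sum>j<n. ip f (\<phi> j) *\<^sub>C \<phi> j"
  have "(\<Sum>j<n. ip f (\<phi> j) *\<^sub>C frame_inv (\<phi> j)) - f = frame_inv (?u n - frame_op f)" for n
    using f by (simp add: frame_inv_diff frame_inv_synthesis)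
  then show "\<forall>\<^sub>F n in sequentially. norm (nrm ((\<Sum>j<n. ip f (\<phi> j) *\<^sub>C frame_inv (\<phi> j)) - f))
      \<le> nrm (?u n - frame_op f) / A"
    using frame_inv_bounded[of "?u _ - frame_op f"] f by simp
  show "(\<lambda>n. nrm (?u n - frame_op f) / A) \<longlonglongrightarrow> 0"
    using tendsto_divide_zero[OF frame_op_limit[OF f]] by simp
qed

text \<open>Moving the inverse onto \<open>g\<close> turns the second factor into a conjugated frame
  coefficient of \<open>frame_inv g\<close>; a product of two square-summable sequences is
  summable.\<close>

lemma frame_reconstruction_summable:
  assumes "f \<in> H" "g \<in> H"
  shows "summable (\<lambda>j. norm (ip f (\<phi> j) * ip (frame_inv (\<phi> j)) g))"
proof (rule summable_comparison_test')
  show "summable (\<lambda>j. (norm (ip f (\<phi> j)))\<^sup>2 + (norm (ip (frame_inv g) (\<phi> j)))\<^sup>2)"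
    using assms by (intro summable_add frame_summable) auto
  fix j :: nat
  have "norm (ip (frame_inv (\<phi> j)) g) = norm (ip (frame_inv g) (\<phi> j))"
    using assms by (simp add: ip_frame_inv_commute ip_commute[of "frame_inv g"])
  then show "norm (norm (ip f (\<phi> j) * ip (frame_inv (\<phi> j)) g))
      \<le> (norm (ip f (\<phi> j)))\<^sup>2 + (norm (ip (frame_inv g) (\<phi> j)))\<^sup>2"
    using norm_mult_le_sum_squares[of "ip f (\<phi> j)" "ip (frame_inv g) (\<phi> j)"]
    by (simp add: norm_mult)
qed

end

section \<open>The space of square-integrable functions\<close>

lemma L2_measurable [measurable_dest]: "f \<in> L2 M \<Longrightarrow> f \<in> borel_measurable M"
  by (simp add: L2_def)

lemma borel_measurable_cnj [measurable (raw)]: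
  "f \<in> borel_measurable M \<Longrightarrow> (\<lambda>x. cnj (f x)) \<in> borel_measurable M"
  by (rule borel_measurable_continuous_on[of cnj]) (intro continuous_intros)

lemma L2_square_integrable: "f \<in> L2 M \<Longrightarrow> integrable M (\<lambda>x. (norm (f x))\<^sup>2)"
  by (simp add: L2_def)

lemma L2_bound:
  assumes "integrable M g" "f \<in> borel_measurable M" "\<And>x. (norm (f x))\<^sup>2 \<le> g x"
  shows "f \<in> L2 M"
proof -
  note [measurable] = assms(2)
  have "integrable M (\<lambda>x. (norm (f x))\<^sup>2)"
  proof (rule Bochner_Integration.integrable_bound[OF assms(1)])
    show "AE x in M. norm ((norm (f x))\<^sup>2) \<le> norm (g x)"
    proof (rule AE_I2)
      show "norm ((norm (f x))\<^sup>2) \<le> norm (g x)" for x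
        using assms(3)[of x] by simp
    qed
  qed measurable
  then show ?thesis using assms(2) by (simp add: L2_def)
qed

lemma L2_add:
  assumes "f \<in> L2 M" "g \<in> L2 M"
  shows "f + g \<in> L2 M"
proof (rule L2_bound)
  show "integrable M (\<lambda>x. 2 * (norm (f x))\<^sup>2 + 2 * (norm (g x))\<^sup>2)"
    using assms by (simp add: L2_square_integrable)
  show "f + g \<in> borel_measurable M"
    unfolding plus_fun_def using assms by measurable
  fix x
  have "(norm ((f + g) x))\<^sup>2 \<le> (norm (f x) + norm (g x))\<^sup>2"
    by (simp add: norm_triangle_ineq power_mono)
  also have "\<dots> \<le> 2 * (norm (f x))\<^sup>2 + 2 * (norm (g x))\<^sup>2"
    using sum_squares_bound[of "norm (f x)" "norm (g x)"] by (simp add: power2_sum)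
  finally show "(norm ((f + g) x))\<^sup>2 \<le> 2 * (norm (f x))\<^sup>2 + 2 * (norm (g x))\<^sup>2" .
qed

lemma L2_scale: "f \<in> L2 M \<Longrightarrow> (\<lambda>x. c * f x) \<in> L2 M"
  by (rule L2_bound[of M "\<lambda>x. (norm c)\<^sup>2 * (norm (f x))\<^sup>2"])
     (auto simp: L2_square_integrable norm_mult power_mult_distrib L2_measurable)

lemma L2_zero: "0 \<in> L2 M"
  by (simp add: L2_def zero_fun_def)

lemma L2_inner_integrable:
  assumes [measurable]: "f \<in> L2 M" "g \<in> L2 M"
  shows "integrable M (\<lambda>x. f x * cnj (g x))"
proof (rule Bochner_Integration.integrable_bound)
  show "integrable M (\<lambda>x. (norm (f x))\<^sup>2 + (norm (g x))\<^sup>2)"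
    using assms by (simp add: L2_square_integrable)
  show "(\<lambda>x. f x * cnj (g x)) \<in> borel_measurable M"
    by measurable
  show "AE x in M. norm (f x * cnj (g x)) \<le> norm ((norm (f x))\<^sup>2 + (norm (g x))\<^sup>2)"
    using norm_mult_le_sum_squares[of "f _" "cnj (g _)"] by simp
qed

lemma L2_inner_self: "L2_inner M f f = of_real ((L2_norm M f)\<^sup>2)"
proof -
  have "L2_inner M f f = (LINT x|M. complex_of_real ((norm (f x))\<^sup>2))"
    unfolding L2_inner_def by (simp only: complex_norm_square)
  also have "\<dots> = of_real (LINT x|M. (norm (f x))\<^sup>2)"
    by (rule integral_complex_of_real)
  finally show ?thesis by (simp add: L2_norm_def)
qed

lemma vector_space_fun: "vector_space (\<lambda>c f x. c * f x :: complex)"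
  by standard (auto simp: fun_eq_iff algebra_simps)

text \<open>Functions equal almost everywhere stay distinct, so the form is only semidefinite. The
  rewrite clause phrases the inherited facts with \<open>L2_norm\<close>.\<close>

global_interpretation L2: semi_inner_space "\<lambda>c f x. c * f x" "L2 M" "L2_inner M"
  rewrites "semi_inner_space.nrm (L2_inner M) = L2_norm M"
  for M :: "'a measure"
proof -
  interpret fun_space: vector_space "\<lambda>c (f :: 'a \<Rightarrow> complex) x. c * f x"
    by (rule vector_space_fun)
  show "semi_inner_space (\<lambda>c f x. c * f x) (L2 M) (L2_inner M)"
  proof
    show "fun_space.subspace (L2 M)"
      unfolding fun_space.subspace_def by (auto intro: L2_zero L2_add L2_scale)
    show "L2_inner M (f + g) h = L2_inner M f h + L2_inner M g h"
      if "f \<in> L2 M" "g \<in> L2 M" "h \<in> L2 M" for f g h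
      unfolding L2_inner_def using that by (simp add: distrib_right L2_inner_integrable)
    show "L2_inner M g f = cnj (L2_inner M f g)" for f g
      unfolding L2_inner_def by (subst Bochner_Integration.integral_cnj[symmetric]) (simp add: mult.commute)
    show "L2_inner M (\<lambda>x. c * f x) g = c * L2_inner M f g" for c f g
      unfolding L2_inner_def by (simp add: mult.assoc)
    show "0 \<le> Re (L2_inner M f f)" for f
      by (simp add: L2_inner_self)
  qed
  then show "semi_inner_space.nrm (L2_inner M) = L2_norm M"
    by (auto simp: fun_eq_iff semi_inner_space.nrm_def L2_inner_self L2_norm_def)
qed

lemma nrm_L2_inner: "semi_inner_space.nrm (L2_inner M) = L2_norm M"
  by (auto simp: fun_eq_iff semi_inner_space.nrm_def[OF L2.semi_inner_space_axioms]
      L2_inner_self L2_norm_def)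

text \<open>\<open>L2_lim\<close> asks in addition that the differences lie in \<open>L2 M\<close>,
  which is automatic for members of \<open>L2 M\<close>.\<close>

lemma L2_lim_iff:
  assumes "\<And>n. u n \<in> L2 M" "h \<in> L2 M"
  shows "L2_lim M u h \<longleftrightarrow> (\<lambda>n. L2_norm M (u n - h)) \<longlonglongrightarrow> 0"
  using L2.H_diff[OF assms] by (simp add: L2_lim_def fun_diff_def)

section \<open>Completeness of the square-integrable functions\<close>

lemma nn_integral_L2_norm:
  assumes "f \<in> L2 M"
  shows "(\<integral>\<^sup>+x. ennreal ((norm (f x))\<^sup>2) \<partial>M) = ennreal ((L2_norm M f)\<^sup>2)"
  using nn_integral_eq_integral[OF L2_square_integrable[OF assms]] by (simp add: L2_norm_def)

text \<open>Membership and norm bound at once from a nonnegative integral, the form in which Fatou's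
  lemma delivers its estimate.\<close>

lemma L2_normI:
  assumes [measurable]: "f \<in> borel_measurable M" and "0 \<le> c"
    and le: "(\<integral>\<^sup>+x. ennreal ((norm (f x))\<^sup>2) \<partial>M) \<le> ennreal (c\<^sup>2)"
  shows "f \<in> L2 M" "L2_norm M f \<le> c"
proof -
  have "integrable M (\<lambda>x. (norm (f x))\<^sup>2)"
    using le by (intro integrableI_bounded) (auto simp: le_less_trans)
  then show f: "f \<in> L2 M" by (simp add: L2_def)
  have "(L2_norm M f)\<^sup>2 \<le> c\<^sup>2"
    using le nn_integral_L2_norm[OF f] by simp
  then show "L2_norm M f \<le> c"
    using \<open>0 \<le> c\<close> by (rule power2_le_imp_le)
qed

text \<open>On a space of possibly infinite mass the L2 norm does not control the integral of the
  increment |d_k|, so weighted squares are summed: 2^k |d_k|^2 has integral at most 2^k 4^-k =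
  2^-k.\<close>

lemma AE_convergent_of_summable_L2_norm:
  fixes v :: "nat \<Rightarrow> 'a \<Rightarrow> complex"
  assumes v: "\<And>k. v k \<in> L2 M" and small: "\<And>k. L2_norm M (v (Suc k) - v k) \<le> (1 / 2) ^ k"
  shows "AE x in M. convergent (\<lambda>k. v k x)"
proof -
  define d where "d k = v (Suc k) - v k" for k
  have d: "d k \<in> L2 M" for k using v by (simp add: d_def)
  note [measurable] = L2_measurable[OF d]
  have "(\<integral>\<^sup>+x. (\<Sum>k. ennreal (2 ^ k * (norm (d k x))\<^sup>2)) \<partial>M)
      = (\<Sum>k. \<integral>\<^sup>+x. ennreal (2 ^ k * (norm (d k x))\<^sup>2) \<partial>M)"
    by (rule nn_integral_suminf) measurable
  also have "\<dots> \<le> (\<Sum>k. ennreal ((1 / 2) ^ k))"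
  proof (rule suminf_le)
    fix k
    have "(\<integral>\<^sup>+x. ennreal (2 ^ k * (norm (d k x))\<^sup>2) \<partial>M) = ennreal (2 ^ k) * ennreal ((L2_norm M (d k))\<^sup>2)"
      by (simp add: ennreal_mult' nn_integral_cmult nn_integral_L2_norm[OF d])
    also have "\<dots> = ennreal (2 ^ k * (L2_norm M (d k))\<^sup>2)"
      by (simp add: ennreal_mult')
    also have "2 ^ k * (L2_norm M (d k))\<^sup>2 \<le> 2 ^ k * ((1 / 2) ^ k)\<^sup>2"
      using small d by (intro mult_left_mono power_mono) (auto simp: d_def)
    also have "(2::real) ^ k * ((1 / 2) ^ k)\<^sup>2 = (1 / 2) ^ k"
      by (simp add: power2_eq_square flip: power_mult_distrib mult.assoc)
    finally show "(\<integral>\<^sup>+x. ennreal (2 ^ k * (norm (d k x))\<^sup>2) \<partial>M) \<le> ennreal ((1 / 2) ^ k)"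
      by (simp add: ennreal_leI)
  qed auto
  also have "\<dots> = ennreal 2"
    by (rule suminf_ennreal_eq) (use geometric_sums[of "1 / 2 :: real"] in auto)
  finally have "(\<integral>\<^sup>+x. (\<Sum>k. ennreal (2 ^ k * (norm (d k x))\<^sup>2)) \<partial>M) \<noteq> \<infinity>"
    by (auto simp: top_unique)
  then have "AE x in M. (\<Sum>k. ennreal (2 ^ k * (norm (d k x))\<^sup>2)) \<noteq> \<infinity>"
    by (intro nn_integral_PInf_AE) measurable
  then show ?thesis
  proof eventually_elim
    case (elim x)
    then have "summable (\<lambda>k. 2 ^ k * (norm (d k x))\<^sup>2)"
      by (intro summable_suminf_not_top) auto
    moreover have "summable (\<lambda>k. (1 / 2 :: real) ^ k)"
      by (rule summable_geometric) simp
    ultimately have "summable (\<lambda>k. 2 ^ k * (norm (d k x))\<^sup>2 + (1 / 2) ^ k)"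
      by (rule summable_add)
    \<comment> \<open>If |d_k| exceeds 2^-k, then 2^k |d_k| \<ge> 1 and the weighted square
      dominates; otherwise the geometric term does.\<close>
    moreover have "norm (d k x) \<le> 2 ^ k * (norm (d k x))\<^sup>2 + (1 / 2) ^ k" for k
    proof (cases "norm (d k x) \<le> (1 / 2) ^ k")
      case True
      then show ?thesis by (simp add: add_increasing)
    next
      case False
      then have "1 \<le> 2 ^ k * norm (d k x)"
        by (simp add: field_simps)
      then have "norm (d k x) \<le> 2 ^ k * norm (d k x) * norm (d k x)"
        by (metis mult_right_mono mult_1 norm_ge_zero)
      then show ?thesis by (simp add: power2_eq_square add_increasing2)
    qed
    ultimately have "summable (\<lambda>k. d k x)"
      by (rule summable_comparison_test')
    then have "convergent (\<lambda>n. \<Sum>k<n. d k x)"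
      by (simp add: summable_iff_convergent)
    moreover have "(\<Sum>k<n. d k x) = v n x - v 0 x" for n
      using sum_lessThan_telescope[of "\<lambda>k. v k x" n] by (simp add: d_def)
    ultimately show "convergent (\<lambda>k. v k x)"
      by (simp add: convergent_diff_const_right_iff)
  qed
qed

text \<open>A fast Cauchy subsequence converges almost everywhere, and Fatou's lemma shows that its
  pointwise limit is the norm limit of the whole sequence.\<close>

theorem Riesz_Fischer:
  fixes u :: "nat \<Rightarrow> 'a \<Rightarrow> complex"
  assumes u: "\<And>n. u n \<in> L2 M"
    and Cauchy: "\<And>e. e > 0 \<Longrightarrow> \<exists>N. \<forall>m\<ge>N. \<forall>n\<ge>N. L2_norm M (u m - u n) < e"
  shows "\<exists>h\<in>L2 M. (\<lambda>n. L2_norm M (u n - h)) \<longlonglongrightarrow> 0"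
proof -
  have "\<forall>k. \<exists>N. \<forall>m\<ge>N. \<forall>n\<ge>N. L2_norm M (u m - u n) < (1 / 2) ^ k"
    by (intro allI Cauchy) simp
  then obtain N where N: "\<And>k m n. N k \<le> m \<Longrightarrow> N k \<le> n \<Longrightarrow> L2_norm M (u m - u n) < (1 / 2) ^ k"
    by metis
  \<comment> \<open>Summing makes \<open>r k\<close> at least every threshold \<open>N j\<close>
    with \<open>j \<le> k\<close>, even if \<open>N\<close> is not monotone.\<close>
  define r where "r k = (\<Sum>i\<le>k. N i)" for k
  have r: "N j \<le> r k" if "j \<le> k" for j k
    unfolding r_def using that by (intro member_le_sum) auto
  \<comment> \<open>Where the sequence diverges, \<open>lim\<close> has no specified value; this
    happens only on a null set, and \<open>h\<close> is measurable regardless.\<close>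
  define h where "h x = lim (\<lambda>k. u (r k) x)" for x
  note [measurable] = L2_measurable[OF u]
  have h_meas [measurable]: "h \<in> borel_measurable M"
    unfolding h_def by measurable
  have "AE x in M. convergent (\<lambda>k. u (r k) x)"
    by (rule AE_convergent_of_summable_L2_norm) (use N[OF r r] u in \<open>auto intro: less_imp_le\<close>)
  then have AE_lim: "AE x in M. (\<lambda>k. u (r k) x) \<longlonglongrightarrow> h x"
    by (simp add: h_def convergent_LIMSEQ_iff)
  \<comment> \<open>Fatou's lemma along the subsequence: for \<open>k \<ge> K\<close> the function
    \<open>u (r k)\<close> is within 2^-K of \<open>u n\<close>.\<close>
  have close: "u n - h \<in> L2 M \<and> L2_norm M (u n - h) \<le> (1 / 2) ^ K" if "N K \<le> n" for n K
  proof -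
    have "(\<integral>\<^sup>+x. ennreal ((norm ((u n - h) x))\<^sup>2) \<partial>M)
        = (\<integral>\<^sup>+x. liminf (\<lambda>k. ennreal ((norm ((u n - u (r k)) x))\<^sup>2)) \<partial>M)"
    proof (intro nn_integral_cong_AE, use AE_lim in eventually_elim)
      case (elim x)
      then have "(\<lambda>k. ennreal ((norm ((u n - u (r k)) x))\<^sup>2)) \<longlonglongrightarrow> ennreal ((norm ((u n - h) x))\<^sup>2)"
        by (auto intro!: tendsto_intros)
      then show ?case by (simp only: lim_imp_Liminf trivial_limit_sequentially not_False_eq_True)
    qed
    also have "\<dots> \<le> liminf (\<lambda>k. \<integral>\<^sup>+x. ennreal ((norm ((u n - u (r k)) x))\<^sup>2) \<partial>M)"
      by (rule nn_integral_liminf) simp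
    also have "\<dots> \<le> ennreal (((1 / 2) ^ K)\<^sup>2)"
    proof (rule Liminf_le)
      have "(\<integral>\<^sup>+x. ennreal ((norm ((u n - u (r k)) x))\<^sup>2) \<partial>M) \<le> ennreal (((1 / 2) ^ K)\<^sup>2)"
        if "K \<le> k" for k
      proof -
        have "L2_norm M (u n - u (r k)) \<le> (1 / 2) ^ K"
          using N[OF \<open>N K \<le> n\<close> r[OF that]] by simp
        then show ?thesis
          using u by (simp add: nn_integral_L2_norm power_mono ennreal_leI del: minus_apply)
      qed
      then show "\<forall>\<^sub>F k in sequentially. (\<integral>\<^sup>+x. ennreal ((norm ((u n - u (r k)) x))\<^sup>2) \<partial>M)
          \<le> ennreal (((1 / 2) ^ K)\<^sup>2)"
        by (rule eventually_sequentiallyI)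
    qed simp
    finally show ?thesis
      by (intro conjI L2_normI) (auto simp: fun_diff_def)
  qed
  \<comment> \<open>\<open>close\<close> only puts differences in \<open>L2 M\<close>, so
    \<open>h\<close> is recovered from one of them.\<close>
  have "u (N 0) - (u (N 0) - h) \<in> L2 M"
    using close[of 0 "N 0"] u by (blast intro: L2.H_diff)
  then have "h \<in> L2 M" by simp
  moreover have "(\<lambda>n. L2_norm M (u n - h)) \<longlonglongrightarrow> 0"
  proof (rule LIMSEQ_I)
    fix e :: real assume "e > 0"
    then obtain K where K: "(1 / 2) ^ K < e"
      using real_arch_pow_inv[of e "1 / 2"] by auto
    have "norm (L2_norm M (u n - h) - 0) < e" if "N K \<le> n" for n
      using close[OF that] K L2.nrm_ge_0[of "u n - h" M] by simp
    then show "\<exists>no. \<forall>n\<ge>no. norm (L2_norm M (u n - h) - 0) < e" by blast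
  qed
  ultimately show ?thesis by blast
qed

section \<open>Band-limited functions\<close>

lemma chr_minus: "chr \<xi> (- x) = cnj (chr \<xi> x)"
proof -
  have "chr \<xi> 0 * chr \<xi> 0 = chr \<xi> 0 * 1"
    by (metis add_0 chr_add mult.right_neutral)
  then have "chr \<xi> 0 = 1"
    using mult_left_cancel[OF chr_nonzero] by blast
  then have "chr \<xi> x * chr \<xi> (- x) = 1"
    by (simp flip: chr_add)
  moreover have "chr \<xi> x * cnj (chr \<xi> x) = 1"
    by (simp flip: complex_norm_square)
  ultimately have "chr \<xi> x * chr \<xi> (- x) = chr \<xi> x * cnj (chr \<xi> x)"
    by simp
  then show ?thesis
    using mult_left_cancel[OF chr_nonzero] by blast
qed

lemma chr_diff: "chr \<xi> (y - x) = chr \<xi> y * cnj (chr \<xi> x)"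
  using chr_add[of \<xi> y "- x"] by (simp add: chr_minus)

text \<open>A singleton is compact, so convergence of characters implies convergence at
  \<open>x\<close>. This makes the integrands on the dual group Borel measurable.\<close>

lemma continuous_on_chr_at: "continuous_on UNIV (\<lambda>\<xi>. chr \<xi> x)"
proof -
  have "((\<lambda>\<xi>. chr \<xi> x) \<longlongrightarrow> chr \<psi> x) (nhds \<psi>)" for \<psi>
  proof (rule tendstoI)
    fix e :: real assume "e > 0"
    then show "\<forall>\<^sub>F \<xi> in nhds \<psi>. dist (chr \<xi> x) (chr \<psi> x) < e"
      unfolding eventually_nhds_character by (intro exI[of _ "{x}"] exI[of _ e]) auto
  qed
  then have "((\<lambda>\<xi>. chr \<xi> x) \<longlongrightarrow> chr \<psi> x) (at \<psi>)" for \<psi>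
    by (rule tendsto_mono[rotated]) (simp add: at_within_def)
  then show ?thesis by (simp add: continuous_on_def)
qed

section \<open>The inverse Fourier transform on functions supported in \<open>D\<close>\<close>

locale band_limited =
  fixes \<mu> :: "'a::{topological_ab_group_add, t2_space} measure"
    and \<nu> :: "'a character measure" and D :: "'a character set"
  assumes haar_dual: "haar_measure \<nu>"
    and plancherel: "plancherel_normalized \<mu> \<nu>"
    and compact_D: "compact D"
begin

text \<open>These symbols vanish everywhere off \<open>D\<close>, not merely almost everywhere, so
  that identities between integrands hold pointwise.\<close>

definition E :: "('a character \<Rightarrow> complex) set" where
  "E = {F \<in> L2 \<nu>. \<forall>\<xi>. \<xi> \<notin> D \<longrightarrow> F \<xi> = 0}"

abbreviation W :: "('a character \<Rightarrow> complex) \<Rightarrow> 'a \<Rightarrow> complex" where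
  "W \<equiv> inverse_fourier \<nu>"

abbreviation H :: "('a \<Rightarrow> complex) set" where
  "H \<equiv> H_space \<mu> \<nu> D"

lemma D_sets [measurable]: "D \<in> sets \<nu>"
  using haar_dual compact_D by (simp add: haar_measure_def borel_closed compact_imp_closed)

lemma D_finite: "emeasure \<nu> D < \<infinity>"
  using haar_dual compact_D by (simp add: haar_measure_def)

lemma chr_measurable [measurable]: "(\<lambda>\<xi>. chr \<xi> x) \<in> borel_measurable \<nu>"
proof -
  have "sets \<nu> = sets borel"
    using haar_dual by (simp add: haar_measure_def)
  then show ?thesis
    using borel_measurable_continuous_onI[OF continuous_on_chr_at, of x]
    by (simp cong: measurable_cong_sets)
qed

lemma E_L2: "F \<in> E \<Longrightarrow> F \<in> L2 \<nu>"
  by (simp add: E_def)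

lemma E_measurable [measurable_dest]: "F \<in> E \<Longrightarrow> F \<in> borel_measurable \<nu>"
  by (simp add: E_def L2_measurable)

lemma E_add: "F \<in> E \<Longrightarrow> G \<in> E \<Longrightarrow> F + G \<in> E"
  by (simp add: E_def L2_add)

lemma E_diff: "F \<in> E \<Longrightarrow> G \<in> E \<Longrightarrow> F - G \<in> E"
  by (simp add: E_def)

lemma E_scale: "F \<in> E \<Longrightarrow> (\<lambda>\<xi>. c * F \<xi>) \<in> E"
  by (simp add: E_def L2_scale)

lemma cutoff_in_E:
  assumes [measurable]: "F \<in> L2 \<nu>"
  shows "(\<lambda>\<xi>. indicator D \<xi> * F \<xi>) \<in> E"
proof -
  have "(\<lambda>\<xi>. indicator D \<xi> * F \<xi>) \<in> L2 \<nu>"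
  proof (rule L2_bound)
    show "integrable \<nu> (\<lambda>\<xi>. (norm (F \<xi>))\<^sup>2)"
      using assms by (rule L2_square_integrable)
    show "(\<lambda>\<xi>. indicator D \<xi> * F \<xi>) \<in> borel_measurable \<nu>"
      by measurable
  qed (simp add: indicator_def)
  then show ?thesis by (simp add: E_def)
qed

text \<open>The compact set \<open>D\<close> has finite measure. With \<open>u\<close> the
  conjugated evaluation at \<open>x\<close> this is the symbol of a coherent state, whose norm is
  thus independent of \<open>x\<close>.\<close>

lemma unimodular_in_E:
  assumes [measurable]: "u \<in> borel_measurable \<nu>" and u: "\<And>\<xi>. norm (u \<xi>) = 1"
  shows "(\<lambda>\<xi>. indicator D \<xi> * u \<xi>) \<in> E"
    and "L2_norm \<nu> (\<lambda>\<xi>. indicator D \<xi> * u \<xi>) = sqrt (measure \<nu> D)"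
proof -
  have eq: "(norm (indicator D \<xi> * u \<xi>))\<^sup>2 = indicator D \<xi>" for \<xi>
    using u by (simp add: indicator_def)
  have "integrable \<nu> (indicator D :: _ \<Rightarrow> real)"
    using D_finite by simp
  then have "(\<lambda>\<xi>. indicator D \<xi> * u \<xi>) \<in> L2 \<nu>"
    unfolding L2_def mem_Collect_eq eq by simp
  then show "(\<lambda>\<xi>. indicator D \<xi> * u \<xi>) \<in> E" by (simp add: E_def)
  show "L2_norm \<nu> (\<lambda>\<xi>. indicator D \<xi> * u \<xi>) = sqrt (measure \<nu> D)"
    unfolding L2_norm_def eq by simp
qed

text \<open>Square-integrable functions are integrable on a set of finite measure: the integrand is
  \<open>F\<close> times the conjugate of the square-integrable function \<open>?G\<close>.\<close>

lemma E_integrable: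
  assumes F: "F \<in> E" and [measurable]: "u \<in> borel_measurable \<nu>" and u: "\<And>\<xi>. norm (u \<xi>) = 1"
  shows "integrable \<nu> (\<lambda>\<xi>. u \<xi> * F \<xi>)"
proof -
  let ?G = "\<lambda>\<xi>. indicator D \<xi> * cnj (u \<xi>)"
  have "?G \<in> E" by (rule unimodular_in_E) (simp_all add: u)
  then have "integrable \<nu> (\<lambda>\<xi>. F \<xi> * cnj (?G \<xi>))"
    using F by (intro L2_inner_integrable E_L2)
  moreover have "F \<xi> * cnj (?G \<xi>) = u \<xi> * F \<xi>" for \<xi>
    using F by (cases "\<xi> \<in> D") (auto simp: E_def)
  ultimately show ?thesis by (simp only:)
qed

lemmas E_chr_integrable = E_integrable[OF _ chr_measurable norm_chr]

lemma E_L1: "F \<in> E \<Longrightarrow> F \<in> L1 \<nu>"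
  using E_integrable[of F "\<lambda>_. 1"] by (simp add: L1_def)

text \<open>Symbols are integrable and square-integrable, so the inversion clause of
  \<open>plancherel_normalized\<close> applies to them directly.\<close>

lemma L2_fourier_W: "F \<in> E \<Longrightarrow> L2_fourier \<mu> \<nu> (W F) F"
  using plancherel by (simp add: plancherel_normalized_def E_L1 E_L2)

text \<open>The norms agree for the approximating functions, and the norm is continuous.\<close>

lemma L2_fourier_isometry:
  assumes "L2_fourier \<mu> \<nu> f F"
  shows "L2_norm \<mu> f = L2_norm \<nu> F"
proof -
  obtain g where f: "f \<in> L2 \<mu>" and F: "F \<in> L2 \<nu>" and g: "\<And>n. g n \<in> L1 \<mu> \<inter> L2 \<mu>"
    and lim: "L2_lim \<mu> g f" "L2_lim \<nu> (\<lambda>n. fourier \<mu> (g n)) F"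
    using assms unfolding L2_fourier_def by blast
  have *: "fourier \<mu> (g n) \<in> L2 \<nu>" "L2_norm \<nu> (fourier \<mu> (g n)) = L2_norm \<mu> (g n)" for n
    using plancherel g unfolding plancherel_normalized_def by blast+
  have "(\<lambda>n. L2_norm \<mu> (g n)) \<longlonglongrightarrow> L2_norm \<mu> f"
    by (rule L2.tendsto_nrm) (use g f lim(1) in \<open>simp_all add: L2_lim_iff\<close>)
  moreover have "(\<lambda>n. L2_norm \<nu> (fourier \<mu> (g n))) \<longlonglongrightarrow> L2_norm \<nu> F"
    by (rule L2.tendsto_nrm) (use * F lim(2) in \<open>simp_all add: L2_lim_iff\<close>)
  ultimately show ?thesis
    using LIMSEQ_unique *(2) by simp
qed

lemma W_L2: "F \<in> E \<Longrightarrow> W F \<in> L2 \<mu>"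
  using L2_fourier_W by (auto simp: L2_fourier_def)

lemma W_norm: "F \<in> E \<Longrightarrow> L2_norm \<mu> (W F) = L2_norm \<nu> F"
  by (rule L2_fourier_isometry[OF L2_fourier_W])

lemma W_add: "F \<in> E \<Longrightarrow> G \<in> E \<Longrightarrow> W (F + G) = W F + W G"
  by (simp add: fun_eq_iff inverse_fourier_def distrib_left E_chr_integrable)

lemma W_diff: "F \<in> E \<Longrightarrow> G \<in> E \<Longrightarrow> W (F - G) = W F - W G"
  by (simp add: fun_eq_iff inverse_fourier_def right_diff_distrib E_chr_integrable)

lemma W_scale: "W (\<lambda>\<xi>. c * F \<xi>) = (\<lambda>x. c * W F x)"
  by (simp add: fun_eq_iff inverse_fourier_def mult.left_commute)

text \<open>Polarisation: \<open>W\<close> preserves the norms of \<open>F\<close>, \<open>G\<close>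
  and \<open>F + G\<close>.\<close>

lemma W_inner_Re:
  assumes "F \<in> E" "G \<in> E"
  shows "Re (L2_inner \<mu> (W F) (W G)) = Re (L2_inner \<nu> F G)"
  using L2.nrm_add_power2[of "W F" \<mu> "W G"] L2.nrm_add_power2[of F \<nu> G]
    W_norm[OF E_add[OF assms]] W_norm[OF assms(1)] W_norm[OF assms(2)]
  by (simp add: assms W_L2 E_L2 W_add)

lemma W_inner:
  assumes "F \<in> E" "G \<in> E"
  shows "L2_inner \<mu> (W F) (W G) = L2_inner \<nu> F G"
proof (rule complex_eqI)
  show "Re (L2_inner \<mu> (W F) (W G)) = Re (L2_inner \<nu> F G)"
    by (rule W_inner_Re) (fact assms)+
  \<comment> \<open>The imaginary part is a real part after replacing G by i G, as Re <F, i G> = Im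
    <F, G>.\<close>
  show "Im (L2_inner \<mu> (W F) (W G)) = Im (L2_inner \<nu> F G)"
    using W_inner_Re[OF assms(1) E_scale[OF assms(2), of \<i>]] assms
    by (simp add: W_scale L2.ip_scale_right W_L2 E_L2)
qed

lemma W_set_integral:
  "(LINT \<xi>:D|\<nu>. F \<xi> * chr \<xi> x) = W (\<lambda>\<xi>. indicator D \<xi> * F \<xi>) x"
  unfolding set_lebesgue_integral_def inverse_fourier_def
  by (intro Bochner_Integration.integral_cong) (auto simp: indicator_def)

lemma W_in_H: assumes "F \<in> E" shows "W F \<in> H"
proof -
  have "(\<lambda>\<xi>. indicator D \<xi> * F \<xi>) = F"
    by (rule ext) (use assms in \<open>auto simp: E_def indicator_def\<close>)
  then show ?thesis
    unfolding H_space_def using L2_fourier_W[OF assms] assms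
    by (intro CollectI exI[of _ F]) (auto simp: W_set_integral E_def)
qed

text \<open>The integral over \<open>D\<close> sees only the values of the transform on
  \<open>D\<close>, so cutting it off there gives a preimage in \<open>E\<close>. Together with
  \<open>W_in_H\<close>, \<open>W\<close> maps \<open>E\<close> onto \<open>H\<close>.\<close>

lemma H_cases:
  assumes "f \<in> H"
  obtains F where "F \<in> E" "f = W F"
proof -
  obtain F where F: "L2_fourier \<mu> \<nu> f F" "\<And>x. f x = (LINT \<xi>:D|\<nu>. F \<xi> * chr \<xi> x)"
    using assms unfolding H_space_def by blast
  then have "F \<in> L2 \<nu>" by (simp add: L2_fourier_def)
  then show thesis
    using that[OF cutoff_in_E] F(2) by (simp add: W_set_integral fun_eq_iff)
qed

lemma H_L2: "f \<in> H \<Longrightarrow> f \<in> L2 \<mu>"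
  by (auto simp: H_space_def L2_fourier_def)

section \<open>Coherent states and point evaluations\<close>

lemma coherent_state_eq: "coherent_state \<nu> D x = W (\<lambda>\<xi>. indicator D \<xi> * cnj (chr \<xi> x))"
  by (rule ext) (simp add: coherent_state_def g_fun_def chr_diff mult.commute flip: W_set_integral)

lemma coherent_symbol:
  "(\<lambda>\<xi>. indicator D \<xi> * cnj (chr \<xi> x)) \<in> E"
  "L2_norm \<nu> (\<lambda>\<xi>. indicator D \<xi> * cnj (chr \<xi> x)) = sqrt (measure \<nu> D)"
  by (rule unimodular_in_E; simp)+

lemma coherent_state_in_H: "coherent_state \<nu> D x \<in> H"
  unfolding coherent_state_eq by (rule W_in_H) (rule coherent_symbol)

lemma coherent_state_norm: "L2_norm \<mu> (coherent_state \<nu> D x) = sqrt (measure \<nu> D)"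
  unfolding coherent_state_eq by (simp add: W_norm coherent_symbol)

text \<open>The isometry moves the inner product to the dual group, where pairing with the symbol of
  the coherent state is the inverse Fourier integral at \<open>x\<close>.\<close>

lemma reproducing:
  assumes "f \<in> H"
  shows "L2_inner \<mu> f (coherent_state \<nu> D x) = f x"
proof -
  obtain F where F: "F \<in> E" "f = W F" using assms by (rule H_cases)
  have "F \<xi> * cnj (indicator D \<xi> * cnj (chr \<xi> x)) = chr \<xi> x * F \<xi>" for \<xi>
    using F(1) by (cases "\<xi> \<in> D") (auto simp: E_def)
  then show ?thesis
    unfolding coherent_state_eq F(2) W_inner[OF F(1) coherent_symbol(1)]
    by (simp only: L2_inner_def inverse_fourier_def)
qed

text \<open>Cauchy-Schwarz in the reproducing formula. The constant does not depend on
  \<open>x\<close>, so norm convergence in \<open>H\<close> implies uniform convergence on the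
  group.\<close>

lemma evaluation_bound:
  assumes "f \<in> H"
  shows "norm (f x) \<le> L2_norm \<mu> f * sqrt (measure \<nu> D)"
  using L2.Cauchy_Schwarz[OF H_L2[OF assms] H_L2[OF coherent_state_in_H[of x]]]
  by (simp add: reproducing[OF assms] coherent_state_norm)

text \<open>\<open>W\<close> is isometric from \<open>E\<close> onto \<open>H\<close>, so the
  Riesz-Fischer theorem can be applied to the symbols.\<close>

lemma H_complete:
  assumes u: "\<And>n. u n \<in> H"
    and Cauchy: "\<And>e. e > 0 \<Longrightarrow> \<exists>N. \<forall>m\<ge>N. \<forall>n\<ge>N. L2_norm \<mu> (u m - u n) < e"
  shows "\<exists>h\<in>H. (\<lambda>n. L2_norm \<mu> (u n - h)) \<longlonglongrightarrow> 0"
proof -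
  have "\<exists>F\<in>E. u n = W F" for n
    using H_cases[OF u[of n]] by blast
  then obtain F where F: "\<And>n. F n \<in> E" "\<And>n. u n = W (F n)"
    by metis
  have "L2_norm \<mu> (u m - u n) = L2_norm \<nu> (F m - F n)" for m n
    using W_norm[OF E_diff[OF F(1) F(1)], of m n] by (simp add: F W_diff)
  then obtain G where G: "G \<in> L2 \<nu>" "(\<lambda>n. L2_norm \<nu> (F n - G)) \<longlonglongrightarrow> 0"
    using Riesz_Fischer[of F \<nu>] Cauchy E_L2[OF F(1)] by auto
  \<comment> \<open>The limit \<open>G\<close> may be nonzero off \<open>D\<close>. Cutting it off
    brings it no farther from the \<open>F n\<close>, which vanish there.\<close>
  define G' where "G' = (\<lambda>\<xi>. indicator D \<xi> * G \<xi>)"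
  have G': "G' \<in> E"
    unfolding G'_def using G(1) by (rule cutoff_in_E)
  have le: "L2_norm \<nu> (F n - G') \<le> L2_norm \<nu> (F n - G)" for n
    unfolding L2_norm_def
  proof (intro real_sqrt_le_mono integral_mono)
    show "integrable \<nu> (\<lambda>\<xi>. (norm ((F n - G') \<xi>))\<^sup>2)"
      by (intro L2_square_integrable L2.H_diff E_L2 F G')
    show "integrable \<nu> (\<lambda>\<xi>. (norm ((F n - G) \<xi>))\<^sup>2)"
      by (intro L2_square_integrable L2.H_diff E_L2 F G)
    show "(norm ((F n - G') \<xi>))\<^sup>2 \<le> (norm ((F n - G) \<xi>))\<^sup>2" for \<xi>
      using F(1)[of n] by (cases "\<xi> \<in> D") (auto simp: G'_def E_def)
  qed
  have "L2_norm \<mu> (u n - W G') = L2_norm \<nu> (F n - G')" for n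
    using W_norm[OF E_diff[OF F(1) G'], of n] by (simp add: F G' W_diff)
  then have "(\<lambda>n. L2_norm \<mu> (u n - W G')) \<longlonglongrightarrow> 0"
    by (intro Lim_null_comparison[OF _ G(2)]) (use le L2.nrm_ge_0[OF E_L2[OF E_diff[OF F(1) G']]] in auto)
  then show ?thesis
    using W_in_H[OF G'] by blast
qed

text \<open>A null symbol has integral zero against the characters for each \<open>x\<close>, so the
  function vanishes at every point. This makes the norm definite on honest functions.\<close>

lemma W_eq_0:
  assumes "F \<in> E" "L2_norm \<nu> F = 0"
  shows "W F = 0"
proof -
  have "(LINT \<xi>|\<nu>. (norm (F \<xi>))\<^sup>2) = 0"
    using assms(2) by (simp add: L2_norm_def)
  then have "AE \<xi> in \<nu>. (norm (F \<xi>))\<^sup>2 = 0"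
    using integral_nonneg_eq_0_iff_AE[OF L2_square_integrable[OF E_L2[OF assms(1)]]] by simp
  then have "AE \<xi> in \<nu>. chr \<xi> x * F \<xi> = 0" for x
    by eventually_elim simp
  then show ?thesis
    by (auto simp: inverse_fourier_def fun_eq_iff intro!: integral_eq_zero_AE)
qed

text \<open>The inner product axioms are inherited from \<open>L2 \<mu>\<close>; closure,
  definiteness and completeness come from the symbols.\<close>

sublocale H: hilbert_carrier "\<lambda>c f x. c * f x" H "L2_inner \<mu>"
  rewrites "semi_inner_space.nrm (L2_inner \<mu>) = L2_norm \<mu>"
proof -
  show "semi_inner_space.nrm (L2_inner \<mu>) = L2_norm \<mu>"
    by (rule nrm_L2_inner)
  show "hilbert_carrier (\<lambda>c f x. c * f x) H (L2_inner \<mu>)"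
  proof
    show "L2.subspace H"
      unfolding L2.subspace_def
    proof (intro conjI ballI allI)
      have "0 \<in> E" by (simp add: E_def)
      moreover have "W 0 = 0" by (simp add: inverse_fourier_def fun_eq_iff)
      ultimately show "0 \<in> H" using W_in_H[of 0] by simp
    next
      fix f g assume f: "f \<in> H" and g: "g \<in> H"
      obtain F where F: "F \<in> E" "f = W F" using f by (rule H_cases)
      obtain G where G: "G \<in> E" "g = W G" using g by (rule H_cases)
      show "f + g \<in> H" using W_in_H[OF E_add[OF F(1) G(1)]] F G by (simp add: W_add)
    next
      fix c f assume f: "f \<in> H"
      obtain F where F: "F \<in> E" "f = W F" using f by (rule H_cases)
      show "(\<lambda>x. c * f x) \<in> H" using W_in_H[OF E_scale[OF F(1), of c]] F by (simp add: W_scale)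
    qed
    fix f assume f: "f \<in> H" and norm_0: "semi_inner_space.nrm (L2_inner \<mu>) f = 0"
    obtain F where F: "F \<in> E" "f = W F" using f by (rule H_cases)
    then show "f = 0"
      using norm_0 W_eq_0[OF F(1)] unfolding nrm_L2_inner by (simp add: W_norm)
  next
    fix u :: "nat \<Rightarrow> 'a \<Rightarrow> complex"
    assume "\<And>n. u n \<in> H" "\<And>e. e > 0 \<Longrightarrow>
      \<exists>N. \<forall>m\<ge>N. \<forall>n\<ge>N. semi_inner_space.nrm (L2_inner \<mu>) (u m - u n) < e"
    then show "\<exists>h\<in>H. (\<lambda>n. semi_inner_space.nrm (L2_inner \<mu>) (u n - h)) \<longlonglongrightarrow> 0"
      unfolding nrm_L2_inner by (rule H_complete)
  qed (fact L2.ip_add_left[OF H_L2 H_L2 H_L2] L2.ip_scale_left[OF H_L2 H_L2]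
      L2.ip_commute[OF H_L2 H_L2] L2.Re_ip_ge_0[OF H_L2])+
qed

end

section \<open>From the abstract frame to sampled values\<close>

lemma sum_fun_apply: "(\<Sum>j\<in>J. f j) x = (\<Sum>j\<in>J. f j x)"
  by (induction J rule: infinite_finite_induct) auto

text \<open>Links the pointwise series of concrete functions with the sums in the additive group of
  functions used by the abstract theory.\<close>

lemma sum_fun_eq: "(\<lambda>x. \<Sum>j\<in>J. f j x) = (\<Sum>j\<in>J. f j)"
  by (simp add: fun_eq_iff sum_fun_apply)

lemma bounded_operator_onI:
  assumes "\<And>f. f \<in> H \<Longrightarrow> T f \<in> H"
    and "\<And>f g. f \<in> H \<Longrightarrow> g \<in> H \<Longrightarrow> T (f + g) = T f + T g"
    and "\<And>c f. f \<in> H \<Longrightarrow> T (\<lambda>x. c * f x) = (\<lambda>x. c * T f x)"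
    and "\<And>f. f \<in> H \<Longrightarrow> L2_norm M (T f) \<le> C * L2_norm M f"
  shows "bounded_operator_on M H T"
  unfolding bounded_operator_on_def
proof (intro conjI ballI allI exI[of _ C])
  show "T (\<lambda>x. f x + g x) = (\<lambda>x. T f x + T g x)" if "f \<in> H" "g \<in> H" for f g
    using assms(2)[OF that] by (simp only: plus_fun_def)
qed (use assms in auto)

theorem theorem9p2:
  fixes \<mu> :: "'a::{topological_ab_group_add, t2_space} measure"
    and \<nu> :: "'a character measure"
    and D :: "'a character set"
    and y :: "nat \<Rightarrow> 'a"
  defines "H \<equiv> H_space \<mu> \<nu> D"
    and "\<phi> \<equiv> (\<lambda>j. coherent_state \<nu> D (y j))"
    and "S \<equiv> frame_operator \<mu> \<nu> D y"
  assumes "locally_compact_space (euclidean :: 'a topology)"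
    and "sigma_compact (UNIV :: 'a set)"
    and "haar_measure \<mu>" and "haar_measure \<nu>" and "plancherel_normalized \<mu> \<nu>"
    and "compact D"
    and "is_frame \<mu> H \<phi>"
  shows "(\<forall>f\<in>H. S f \<in> H \<and> L2_lim \<mu> (\<lambda>n x. \<Sum>j<n. f (y j) * \<phi> j x) (S f)) \<and>
    bounded_operator_on \<mu> H S \<and>
    positive_operator_on \<mu> H S \<and>
    invertible_operator_on \<mu> H S \<and>
    (\<forall>f\<in>H.
       (\<forall>x. (\<lambda>j. f (y j) * inv_into H S (\<phi> j) x) sums f x) \<and>
       (\<forall>x. summable (\<lambda>j. norm (f (y j) * inv_into H S (\<phi> j) x))) \<and>
       (\<forall>K. compact K \<longrightarrow>
          uniform_limit K (\<lambda>n x. \<Sum>j<n. f (y j) * inv_into H S (\<phi> j) x) f sequentially))"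
proof -
  interpret BL: band_limited \<mu> \<nu> D
    by standard fact+
  obtain A B where AB: "0 < A" "A \<le> B"
    and frame: "\<forall>f\<in>H. summable (\<lambda>j. (norm (L2_inner \<mu> f (\<phi> j)))\<^sup>2) \<and>
      A * (L2_norm \<mu> f)\<^sup>2 \<le> (\<Sum>j. (norm (L2_inner \<mu> f (\<phi> j)))\<^sup>2) \<and>
      (\<Sum>j. (norm (L2_inner \<mu> f (\<phi> j)))\<^sup>2) \<le> B * (L2_norm \<mu> f)\<^sup>2"
    using \<open>is_frame \<mu> H \<phi>\<close> unfolding is_frame_def by (elim exE conjE)
  have \<phi>_in_H: "\<phi> j \<in> H" for j
    by (simp add: \<phi>_def H_def BL.coherent_state_in_H)
  interpret F: hilbert_frame "\<lambda>c f x. c * f x" H "L2_inner \<mu>" \<phi> A B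
    rewrites "semi_inner_space.nrm (L2_inner \<mu>) = L2_norm \<mu>"
  proof -
    have "hilbert_carrier (\<lambda>c f x. c * f x) H (L2_inner \<mu>)"
      unfolding H_def by (rule BL.H.hilbert_carrier_axioms)
    then show "hilbert_frame (\<lambda>c f x. c * f x) H (L2_inner \<mu>) \<phi> A B"
      unfolding hilbert_frame_def hilbert_frame_axioms_def nrm_L2_inner
      using AB frame \<phi>_in_H by (intro conjI allI impI) simp_all
  qed (rule nrm_L2_inner)
  have H_L2: "f \<in> L2 \<mu>" if "f \<in> H" for f
    using that unfolding H_def by (rule BL.H_L2)
  have point: "f x = L2_inner \<mu> f (coherent_state \<nu> D x)" if "f \<in> H" for f x
    using BL.reproducing that unfolding H_def by simp
  have sample: "f (y j) = L2_inner \<mu> f (\<phi> j)" if "f \<in> H" for f j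
    unfolding \<phi>_def using that by (rule point)
  have partial_sum: "(\<lambda>x. \<Sum>j<n. f (y j) * g j x) = (\<Sum>j<n. (\<lambda>x. L2_inner \<mu> f (\<phi> j) * g j x))"
    if "f \<in> H" for f g n
    unfolding sample[OF that] by (rule sum_fun_eq)
  have L2_lim: "L2_lim \<mu> (\<lambda>n x. \<Sum>j<n. f (y j) * \<phi> j x) h \<longleftrightarrow>
      (\<lambda>n. L2_norm \<mu> ((\<Sum>j<n. (\<lambda>x. L2_inner \<mu> f (\<phi> j) * \<phi> j x)) - h)) \<longlonglongrightarrow> 0"
    if "f \<in> H" "h \<in> H" for f h
    unfolding partial_sum[OF that(1)] using that
    by (intro L2_lim_iff H_L2) (simp_all add: F.synthesis_in_H)
  \<comment> \<open>Both sides are definite descriptions, and \<open>L2_lim\<close> makes their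
    predicates equivalent on \<open>H\<close>.\<close>
  have S: "S f = F.frame_op f" if "f \<in> H" for f
    unfolding S_def frame_operator_def F.frame_op_def
    by (intro arg_cong[where f = The] ext conj_cong)
       (use L2_lim that in \<open>auto simp: H_def \<phi>_def\<close>)
  \<comment> \<open>\<open>inv_into H\<close> picks a preimage within \<open>H\<close>, where the
    two operators agree.\<close>
  have S_inv: "inv_into H S = F.frame_inv"
    by (rule ext) (simp add: inv_into_def S cong: conj_cong)
  have converges: "\<forall>f\<in>H. S f \<in> H \<and> L2_lim \<mu> (\<lambda>n x. \<Sum>j<n. f (y j) * \<phi> j x) (S f)"
    using F.frame_op_limit by (simp add: S L2_lim)
  have bounded: "bounded_operator_on \<mu> H S"
    by (rule bounded_operator_onI[where C = B])
      (simp_all add: S F.frame_op_add F.frame_op_scale F.frame_op_bounded)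
  have positive: "positive_operator_on \<mu> H S"
    unfolding positive_operator_on_def
    using F.frame_summable by (auto simp: S F.frame_op_self complex_nonneg_Reals_iff intro!: suminf_nonneg)
  have bij: "bij_betw S H H"
    using F.frame_op_bij by (simp add: S cong: bij_betw_cong)
  have inverse_bounded: "bounded_operator_on \<mu> H (inv_into H S)"
    unfolding S_inv
    by (rule bounded_operator_onI[where C = "1 / A"])
      (simp_all add: F.frame_inv_add F.frame_inv_scale F.frame_inv_bounded)
  have reconstruction: "uniform_limit UNIV (\<lambda>n x. \<Sum>j<n. f (y j) * inv_into H S (\<phi> j) x) f sequentially"
    if f: "f \<in> H" for f
  proof (rule uniform_limitI)
    fix e :: real assume "e > 0"
    \<comment> \<open>The remainders lie in \<open>H\<close>, so \<open>evaluation_bound\<close>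
      turns their convergence in norm into a bound uniform in \<open>x\<close>.\<close>
    define r where "r n = (\<lambda>x. \<Sum>j<n. f (y j) * inv_into H S (\<phi> j) x) - f" for n
    have r_eq: "r n = (\<Sum>j<n. (\<lambda>x. L2_inner \<mu> f (\<phi> j) * F.frame_inv (\<phi> j) x)) - f" for n
      unfolding r_def partial_sum[OF f] S_inv ..
    have r_H: "r n \<in> H" for n
      unfolding r_eq using f by (intro F.H_diff F.H_sum F.H_scale F.frame_inv_in_H \<phi>_in_H)
    have "(\<lambda>n. L2_norm \<mu> (r n) * sqrt (measure \<nu> D)) \<longlonglongrightarrow> 0"
      unfolding r_eq using F.frame_reconstruction[OF f] by (rule tendsto_mult_left_zero)
    then have "\<forall>\<^sub>F n in sequentially. L2_norm \<mu> (r n) * sqrt (measure \<nu> D) < e"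
      using \<open>e > 0\<close> by (rule order_tendstoD)
    then show "\<forall>\<^sub>F n in sequentially. \<forall>x\<in>UNIV.
        dist (\<Sum>j<n. f (y j) * inv_into H S (\<phi> j) x) (f x) < e"
    proof eventually_elim
      case (elim n)
      have "norm (r n x) \<le> L2_norm \<mu> (r n) * sqrt (measure \<nu> D)" for x
        using BL.evaluation_bound r_H[of n] unfolding H_def by blast
      then show ?case
        using elim by (auto simp: r_def dist_norm intro: le_less_trans)
    qed
  qed
  \<comment> \<open>Evaluation at \<open>x\<close> is pairing with the coherent state at
    \<open>x\<close>, which serves as \<open>g\<close> in
    \<open>frame_reconstruction_summable\<close>.\<close>
  have absolute: "summable (\<lambda>j. norm (f (y j) * inv_into H S (\<phi> j) x))" if f: "f \<in> H" for f x
  proof -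
    have "coherent_state \<nu> D x \<in> H"
      unfolding H_def by (rule BL.coherent_state_in_H)
    moreover have "inv_into H S (\<phi> j) x = L2_inner \<mu> (F.frame_inv (\<phi> j)) (coherent_state \<nu> D x)" for j
      unfolding S_inv by (intro point F.frame_inv_in_H \<phi>_in_H)
    ultimately show ?thesis
      using F.frame_reconstruction_summable[OF f] by (simp only: sample[OF f])
  qed
  have "(\<lambda>j. f (y j) * inv_into H S (\<phi> j) x) sums f x" if "f \<in> H" for f x
    unfolding sums_def using tendsto_uniform_limitI[OF reconstruction[OF that] UNIV_I] .
  moreover have "uniform_limit K (\<lambda>n x. \<Sum>j<n. f (y j) * inv_into H S (\<phi> j) x) f sequentially"
    if "f \<in> H" for f K
    using uniform_limit_on_subset[OF reconstruction[OF that] subset_UNIV] .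
  ultimately show ?thesis
    unfolding invertible_operator_on_def
    by (intro conjI ballI allI impI converges bounded positive bij inverse_bounded absolute)
qed

end
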